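(* Let $T$ be a plane rooted tree with root $r$ and $\mu$ a $T$-partition of $N$. Then every irreducible $S^\lambda$ contained in the $\mathfrak S_N$-module $\tilde S^{T,\mu}$ has a Young diagram with exactly $|T|$ columns, and its last column has length $\mu(r)$.
   Context: All vector spaces over $\mathbb C$. $T$ is a plane rooted tree; $|T|$ is its number of nodes. A $T$-partition of $N$ is a labeling $\mu$ of the nodes by positive integers with $\sum_a\mu(a)=N$ and $\mu(a)\le\mu(b)$ whenever $a$ is the parent of $b$. A $\mu$-tableau assigns to each node $a$ an ordered column $Col(a)$ of $\mu(a)$ distinct positive integers, the column entry sets being disjoint with union $[N]$; $\mathcal T_{T,\mu}$ is the set of these. $M^{T,\mu}$ is generated by $\mathcal T_{T,\mu}$ modulo the column relations $t+s$ ($s$ obtained from $t$ by switching two entries in the same column); $\bar t$ is the class of $t$; $\mathfrak S_N$ acts by permuting entries. For an internal (non-leaf) node $a$ with set $D_a$ of (proper) descendants and $t\in\mathcal T_{T,\mu}$, the tree Garnir relation of the second kind is $\tilde g_a^t=|D_a|\,\mu(a)\,\bar t-\sum_s\bar s$, summing over all $s$ obtained from $t$ by exchanging any entry of $Col(a)$ with any entry of $\bigcup_{b\in D_a}Col(b)$. $\tilde S^{T,\mu}=M^{T,\mu}/\tilde G^{T,\mu}$ where $\tilde G^{T,\mu}$ is the span of all $\tilde g_a^t$. $S^\lambda$ is the Specht module. *)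

theory Defs
  imports Complex_Main "HOL-Library.Sublist" "HOL-Algebra.AbelCoset" "HOL-Algebra.Sym_Groups" "HOL-Algebra.Module"
begin

section \<open>Complex representations of symmetric groups\<close>

definition complex_field :: "complex ring" where
  "complex_field = \<lparr>carrier = UNIV, monoid.mult = (*), one = 1, ring.zero = 0, ring.add = (+)\<rparr>"

text \<open>
  A HOL-Algebra module over the complex numbers together with an action of permutations of the
  natural numbers; the group acting is \<open>sym_group N\<close>.  As for all HOL-Algebra modules, the
  fields \<open>mult\<close> and \<open>one\<close> of the underlying ring record play no role.
\<close>

record 'v perm_module = "(complex, 'v) module" +
  perm_act :: "(nat \<Rightarrow> nat) \<Rightarrow> 'v \<Rightarrow> 'v"

text \<open>
  The vector space with basis a finite set \<open>B\<close>, realised as the functions vanishing outside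
  \<open>B\<close>.  If \<open>\<phi>\<close> is an action of permutations on \<open>B\<close>, then
  \<open>\<sigma>\<close> maps the basis vector of \<open>x\<close> to that of \<open>\<phi> \<sigma> x\<close>.
\<close>

definition free_perm_module ::
    "((nat \<Rightarrow> nat) \<Rightarrow> 'x \<Rightarrow> 'x) \<Rightarrow> 'x set \<Rightarrow> ('x \<Rightarrow> complex) perm_module" where
  "free_perm_module \<phi> B =
    \<lparr>carrier = {f. \<forall>x. x \<notin> B \<longrightarrow> f x = 0},
     monoid.mult = undefined, one = undefined,
     ring.zero = (\<lambda>x. 0), ring.add = (\<lambda>f g x. f x + g x),
     module.smult = (\<lambda>c f x. c * f x),
     perm_act = (\<lambda>\<sigma> f x. f (\<phi> (Hilbert_Choice.inv \<sigma>) x))\<rparr>"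

definition basis_vec :: "'x \<Rightarrow> 'x \<Rightarrow> complex" where
  "basis_vec x = (\<lambda>y. if y = x then 1 else 0)"

definition submodule_span :: "'v perm_module \<Rightarrow> 'v set \<Rightarrow> 'v set" where
  "submodule_span M S = (\<lambda>H. submodule H complex_field M) hull S"

text \<open>
  Elements of the quotient are cosets of \<open>H\<close>.  The union in \<open>smult\<close> is needed
  because the elementwise multiple of a coset by \<open>0\<close> is only \<open>{0}\<close>.
\<close>

definition quotient_module :: "'v perm_module \<Rightarrow> 'v set \<Rightarrow> 'v set perm_module" where
  "quotient_module M H =
    \<lparr>carrier = a_rcosets\<^bsub>M\<^esub> H,
     monoid.mult = undefined, one = undefined,
     ring.zero = H, ring.add = set_add M,
     module.smult = (\<lambda>c X. \<Union>x\<in>X. H +>\<^bsub>M\<^esub> (c \<odot>\<^bsub>M\<^esub> x)),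
     perm_act = (\<lambda>\<sigma> X. perm_act M \<sigma> ` X)\<rparr>"

text \<open>\<open>A\<close> is isomorphic, as an \<open>\<SS>\<^sub>N\<close>-module, to a submodule of \<open>B\<close>.\<close>

definition contained_in :: "nat \<Rightarrow> 'v perm_module \<Rightarrow> 'w perm_module \<Rightarrow> bool" where
  "contained_in N A B \<longleftrightarrow>
    (\<exists>f \<in> hom (add_monoid A) (add_monoid B).
       inj_on f (carrier A) \<and>
       (\<forall>c. \<forall>v \<in> carrier A. f (c \<odot>\<^bsub>A\<^esub> v) = c \<odot>\<^bsub>B\<^esub> f v) \<and>
       (\<forall>\<sigma> \<in> carrier (sym_group N). \<forall>v \<in> carrier A.
          f (perm_act A \<sigma> v) = perm_act B \<sigma> (f v)))"

lemma complex_field_sel [simp]: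
  "carrier complex_field = UNIV" "x \<otimes>\<^bsub>complex_field\<^esub> y = x * y"
  "\<one>\<^bsub>complex_field\<^esub> = 1" "\<zero>\<^bsub>complex_field\<^esub> = 0" "x \<oplus>\<^bsub>complex_field\<^esub> y = x + y"
  by (simp_all add: complex_field_def)

lemma field_complex_field: "field complex_field"
proof -
  have "cring complex_field"
  proof (rule cringI)
    show "abelian_group complex_field"
      by (rule abelian_groupI) (auto intro: exI[of _ "- x" for x] simp: add_eq_0_iff)
    show "comm_monoid complex_field"
      by (rule comm_monoidI) auto
  qed (auto simp: distrib_right)
  moreover have "\<exists>y\<in>carrier complex_field. x \<otimes>\<^bsub>complex_field\<^esub> y = \<one>\<^bsub>complex_field\<^esub>"
    if "x \<noteq> \<zero>\<^bsub>complex_field\<^esub>" for x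
    using that by (intro bexI[of _ "inverse x"]) auto
  ultimately show ?thesis
    by (intro cring.cring_fieldI2) auto
qed

lemma module_free_perm_module: "Module.module complex_field (free_perm_module \<phi> B)"
proof (rule moduleI)
  show "cring complex_field"
    using field_complex_field by (simp add: field.is_ring fieldE)
  show "abelian_group (free_perm_module \<phi> B)"
  proof (rule abelian_groupI)
    fix f assume "f \<in> carrier (free_perm_module \<phi> B)"
    then show "\<exists>g\<in>carrier (free_perm_module \<phi> B). g \<oplus>\<^bsub>free_perm_module \<phi> B\<^esub> f = \<zero>\<^bsub>free_perm_module \<phi> B\<^esub>"
      by (intro bexI[of _ "\<lambda>x. - f x"]) (auto simp: free_perm_module_def)
  qed (auto simp: free_perm_module_def)
qed (auto simp: free_perm_module_def algebra_simps)

lemma submodule_submodule_span: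
  assumes M: "Module.module complex_field M" and S: "S \<subseteq> carrier M"
  shows "submodule (submodule_span M S) complex_field M"
proof -
  interpret Module.module complex_field M by (fact M)
  have car: "submodule (carrier M) complex_field M" by (rule carrier_is_submodule)
  show ?thesis
    unfolding submodule_span_def hull_def
  proof (rule submoduleI)
    show "\<zero>\<^bsub>M\<^esub> \<in> \<Inter>{H. submodule H complex_field M \<and> S \<subseteq> H}"
      by (auto simp: submodule_def dest!: subgroup.one_closed)
    show "\<Inter>{H. submodule H complex_field M \<and> S \<subseteq> H} \<subseteq> carrier M"
      using S car by blast
  qed (simp_all add: submoduleE(3-5))
qed

lemma module_quotient_module:
  assumes M: "Module.module complex_field M" and H: "submodule H complex_field M"
  shows "Module.module complex_field (quotient_module M H)"
proof -
  interpret Module.module complex_field M by (fact M)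
  interpret H: abelian_subgroup H M
    using H by (intro abelian_subgroupI3 additive_subgroupI)
      (auto simp: submodule_def abelian_group_axioms)
  let ?Q = "quotient_module M H"
  have add: "(H +>\<^bsub>M\<^esub> x) <+>\<^bsub>M\<^esub> (H +>\<^bsub>M\<^esub> y) = H +>\<^bsub>M\<^esub> (x \<oplus>\<^bsub>M\<^esub> y)"
    if "x \<in> carrier M" "y \<in> carrier M" for x y
    using that by (rule H.a_rcos_sum)
  have smult: "c \<odot>\<^bsub>?Q\<^esub> (H +>\<^bsub>M\<^esub> x) = H +>\<^bsub>M\<^esub> (c \<odot>\<^bsub>M\<^esub> x)" if x: "x \<in> carrier M" for c x
  proof -
    have "H +>\<^bsub>M\<^esub> (c \<odot>\<^bsub>M\<^esub> y) = H +>\<^bsub>M\<^esub> (c \<odot>\<^bsub>M\<^esub> x)" if y: "y \<in> H +>\<^bsub>M\<^esub> x" for y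
    proof -
      obtain h where h: "h \<in> H" "y = h \<oplus>\<^bsub>M\<^esub> x"
        using y by (auto simp: a_r_coset_def')
      have "c \<odot>\<^bsub>M\<^esub> y = (c \<odot>\<^bsub>M\<^esub> h) \<oplus>\<^bsub>M\<^esub> (c \<odot>\<^bsub>M\<^esub> x)"
        using h x H.a_subset by (auto intro!: smult_r_distr)
      moreover have "c \<odot>\<^bsub>M\<^esub> h \<in> H"
        using submoduleE(4)[OF H] h by simp
      ultimately have "c \<odot>\<^bsub>M\<^esub> y \<in> H +>\<^bsub>M\<^esub> (c \<odot>\<^bsub>M\<^esub> x)"
        by (auto simp: a_r_coset_def')
      then show ?thesis
        using x by (metis H.a_repr_independence' smult_closed complex_field_sel(1) UNIV_I)
    qed
    moreover have "x \<in> H +>\<^bsub>M\<^esub> x" using x by (rule H.a_rcos_self)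
    ultimately have "(\<Union>y\<in>H +>\<^bsub>M\<^esub> x. H +>\<^bsub>M\<^esub> (c \<odot>\<^bsub>M\<^esub> y)) = H +>\<^bsub>M\<^esub> (c \<odot>\<^bsub>M\<^esub> x)"
      by blast
    then show ?thesis by (simp add: quotient_module_def)
  qed
  have carrier: "carrier ?Q = (\<lambda>x. H +>\<^bsub>M\<^esub> x) ` carrier M"
    by (auto simp: quotient_module_def A_RCOSETS_def')
  have add_Q: "X \<oplus>\<^bsub>?Q\<^esub> Y = X <+>\<^bsub>M\<^esub> Y" and zero_Q: "\<zero>\<^bsub>?Q\<^esub> = H" for X Y
    by (simp_all add: quotient_module_def)
  have H0: "H = H +>\<^bsub>M\<^esub> \<zero>\<^bsub>M\<^esub>"
    using H.a_subset by (simp add: a_coset_add_zero)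
  have grp: "abelian_group ?Q"
  proof (rule abelian_groupI)
    show "\<zero>\<^bsub>?Q\<^esub> \<in> carrier ?Q"
      unfolding zero_Q carrier using H0 by blast
    fix X assume "X \<in> carrier ?Q"
    then obtain x where x: "x \<in> carrier M" "X = H +>\<^bsub>M\<^esub> x" by (auto simp: carrier)
    have "(H +>\<^bsub>M\<^esub> \<zero>\<^bsub>M\<^esub>) <+>\<^bsub>M\<^esub> X = X"
      using x by (simp only: add M.zero_closed M.l_zero)
    then show "\<zero>\<^bsub>?Q\<^esub> \<oplus>\<^bsub>?Q\<^esub> X = X"
      unfolding zero_Q add_Q by (simp only: H0[symmetric])
    have "(H +>\<^bsub>M\<^esub> (\<ominus>\<^bsub>M\<^esub> x)) \<oplus>\<^bsub>?Q\<^esub> X = \<zero>\<^bsub>?Q\<^esub>"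
      unfolding zero_Q add_Q using x
      by (simp only: add M.a_inv_closed M.l_neg H0[symmetric])
    then show "\<exists>Y\<in>carrier ?Q. Y \<oplus>\<^bsub>?Q\<^esub> X = \<zero>\<^bsub>?Q\<^esub>"
      using x by (auto simp: carrier)
  qed (auto simp: carrier add add_Q M.a_ac)
  show ?thesis
  proof (rule moduleI)
    show "cring complex_field" by (fact R.is_cring)
    fix a b :: complex and X assume "X \<in> carrier ?Q"
    then obtain x where x: "x \<in> carrier M" "X = H +>\<^bsub>M\<^esub> x" by (auto simp: carrier)
    show "a \<odot>\<^bsub>?Q\<^esub> X \<in> carrier ?Q"
      using x by (auto simp: smult carrier)
    show "(a \<oplus>\<^bsub>complex_field\<^esub> b) \<odot>\<^bsub>?Q\<^esub> X = (a \<odot>\<^bsub>?Q\<^esub> X) \<oplus>\<^bsub>?Q\<^esub> (b \<odot>\<^bsub>?Q\<^esub> X)"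
      using x smult_l_distr[of a b x] by (simp add: smult add add_Q)
    show "(a \<otimes>\<^bsub>complex_field\<^esub> b) \<odot>\<^bsub>?Q\<^esub> X = a \<odot>\<^bsub>?Q\<^esub> (b \<odot>\<^bsub>?Q\<^esub> X)"
      using x smult_assoc1[of a b x] by (simp add: smult)
    show "\<one>\<^bsub>complex_field\<^esub> \<odot>\<^bsub>?Q\<^esub> X = X"
      using x smult_one[of x] by (simp add: smult)
    fix Y assume "Y \<in> carrier ?Q"
    then obtain y where y: "y \<in> carrier M" "Y = H +>\<^bsub>M\<^esub> y" by (auto simp: carrier)
    show "a \<odot>\<^bsub>?Q\<^esub> (X \<oplus>\<^bsub>?Q\<^esub> Y) = (a \<odot>\<^bsub>?Q\<^esub> X) \<oplus>\<^bsub>?Q\<^esub> (a \<odot>\<^bsub>?Q\<^esub> Y)"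
      using x y smult_r_distr[of a x y] by (simp add: smult add add_Q)
  qed (fact grp)
qed

section \<open>Plane rooted trees\<close>

text \<open>
  A node is given by its address: the list of child indices on the path from the root, which
  itself has address \<open>[]\<close>.
\<close>

datatype plane_tree = Node "plane_tree list"

inductive is_node :: "plane_tree \<Rightarrow> nat list \<Rightarrow> bool" where
  root: "is_node T []"
| child: "i < length ts \<Longrightarrow> is_node (ts ! i) a \<Longrightarrow> is_node (Node ts) (i # a)"

definition nodes :: "plane_tree \<Rightarrow> nat list set" where
  "nodes T = {a. is_node T a}"

definition is_parent :: "nat list \<Rightarrow> nat list \<Rightarrow> bool" where
  "is_parent a b \<longleftrightarrow> (\<exists>i. b = a @ [i])"

definition descendants :: "plane_tree \<Rightarrow> nat list \<Rightarrow> nat list set" where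
  "descendants T a = {b \<in> nodes T. strict_prefix a b}"

definition internal_nodes :: "plane_tree \<Rightarrow> nat list set" where
  "internal_nodes T = {a \<in> nodes T. \<exists>b \<in> nodes T. is_parent a b}"

lemma nodes_Node: "nodes (Node ts) = insert [] (\<Union>i<length ts. (#) i ` nodes (ts ! i))"
proof (rule equalityI; rule subsetI)
  fix a assume "a \<in> nodes (Node ts)"
  then have "is_node (Node ts) a" by (simp add: nodes_def)
  then show "a \<in> insert [] (\<Union>i<length ts. (#) i ` nodes (ts ! i))"
    by cases (auto simp: nodes_def)
qed (auto simp: nodes_def intro: is_node.intros)

lemma finite_nodes: "finite (nodes T)"
  by (induction T) (auto simp: nodes_Node)

section \<open>The modules attached to a labelled tree\<close>

definition T_partition :: "plane_tree \<Rightarrow> nat \<Rightarrow> (nat list \<Rightarrow> nat) \<Rightarrow> bool" where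
  "T_partition T N \<mu> \<longleftrightarrow>
    (\<forall>a \<in> nodes T. 0 < \<mu> a) \<and>
    (\<Sum>a \<in> nodes T. \<mu> a) = N \<and>
    (\<forall>a \<in> nodes T. \<forall>b \<in> nodes T. is_parent a b \<longrightarrow> \<mu> a \<le> \<mu> b)"

text \<open>
  The column of the node \<open>a\<close> of a tableau \<open>t\<close> is the list \<open>t a\<close>; outside the nodes
  of the tree, \<open>t\<close> is normalised to \<open>[]\<close>.
\<close>

definition tree_tableaux ::
    "plane_tree \<Rightarrow> nat \<Rightarrow> (nat list \<Rightarrow> nat) \<Rightarrow> (nat list \<Rightarrow> nat list) set" where
  "tree_tableaux T N \<mu> =
    {t. (\<forall>a. a \<notin> nodes T \<longrightarrow> t a = []) \<and>
        (\<forall>a \<in> nodes T. length (t a) = \<mu> a \<and> distinct (t a)) \<and>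
        (\<forall>a \<in> nodes T. \<forall>b \<in> nodes T. a \<noteq> b \<longrightarrow> set (t a) \<inter> set (t b) = {}) \<and>
        (\<Union>a \<in> nodes T. set (t a)) = {1..N}}"

definition permute_entries ::
    "(nat \<Rightarrow> nat) \<Rightarrow> (nat list \<Rightarrow> nat list) \<Rightarrow> nat list \<Rightarrow> nat list" where
  "permute_entries \<sigma> t = (\<lambda>a. map \<sigma> (t a))"

abbreviation switch_entries ::
    "nat \<Rightarrow> nat \<Rightarrow> (nat list \<Rightarrow> nat list) \<Rightarrow> nat list \<Rightarrow> nat list" where
  "switch_entries x y \<equiv> permute_entries (transpose x y)"

definition tableau_module ::
    "plane_tree \<Rightarrow> nat \<Rightarrow> (nat list \<Rightarrow> nat) \<Rightarrow> ((nat list \<Rightarrow> nat list) \<Rightarrow> complex) perm_module" where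
  "tableau_module T N \<mu> = free_perm_module permute_entries (tree_tableaux T N \<mu>)"

definition column_relations ::
    "plane_tree \<Rightarrow> nat \<Rightarrow> (nat list \<Rightarrow> nat) \<Rightarrow> ((nat list \<Rightarrow> nat list) \<Rightarrow> complex) set" where
  "column_relations T N \<mu> =
    submodule_span (tableau_module T N \<mu>)
      {basis_vec t \<oplus>\<^bsub>tableau_module T N \<mu>\<^esub> basis_vec (switch_entries x y t) | t a x y.
         t \<in> tree_tableaux T N \<mu> \<and> a \<in> nodes T \<and> x \<in> set (t a) \<and> y \<in> set (t a) \<and> x \<noteq> y}"

definition M_module ::
    "plane_tree \<Rightarrow> nat \<Rightarrow> (nat list \<Rightarrow> nat) \<Rightarrow> ((nat list \<Rightarrow> nat list) \<Rightarrow> complex) set perm_module" where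
  "M_module T N \<mu> = quotient_module (tableau_module T N \<mu>) (column_relations T N \<mu>)"

definition tableau_class ::
    "plane_tree \<Rightarrow> nat \<Rightarrow> (nat list \<Rightarrow> nat) \<Rightarrow> (nat list \<Rightarrow> nat list)
      \<Rightarrow> ((nat list \<Rightarrow> nat list) \<Rightarrow> complex) set" where
  "tableau_class T N \<mu> t =
    column_relations T N \<mu> +>\<^bsub>tableau_module T N \<mu>\<^esub> basis_vec t"

definition garnir_second ::
    "plane_tree \<Rightarrow> nat \<Rightarrow> (nat list \<Rightarrow> nat) \<Rightarrow> nat list \<Rightarrow> (nat list \<Rightarrow> nat list)
      \<Rightarrow> ((nat list \<Rightarrow> nat list) \<Rightarrow> complex) set" where
  "garnir_second T N \<mu> a t =
    (of_nat (card (descendants T a) * \<mu> a) \<odot>\<^bsub>M_module T N \<mu>\<^esub> tableau_class T N \<mu> t)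
    \<ominus>\<^bsub>M_module T N \<mu>\<^esub>
    (\<Oplus>\<^bsub>M_module T N \<mu>\<^esub> p \<in> set (t a) \<times> (\<Union>b \<in> descendants T a. set (t b)).
       tableau_class T N \<mu> (switch_entries (fst p) (snd p) t))"

definition G_tilde ::
    "plane_tree \<Rightarrow> nat \<Rightarrow> (nat list \<Rightarrow> nat) \<Rightarrow> ((nat list \<Rightarrow> nat list) \<Rightarrow> complex) set set" where
  "G_tilde T N \<mu> =
    submodule_span (M_module T N \<mu>)
      {garnir_second T N \<mu> a t | a t. a \<in> internal_nodes T \<and> t \<in> tree_tableaux T N \<mu>}"

definition S_tilde ::
    "plane_tree \<Rightarrow> nat \<Rightarrow> (nat list \<Rightarrow> nat)
      \<Rightarrow> ((nat list \<Rightarrow> nat list) \<Rightarrow> complex) set set perm_module" where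
  "S_tilde T N \<mu> = quotient_module (M_module T N \<mu>) (G_tilde T N \<mu>)"

lemma switch_entries_tree_tableaux:
  assumes t: "t \<in> tree_tableaux T N \<mu>" and xy: "x \<in> {1..N}" "y \<in> {1..N}"
  shows "switch_entries x y t \<in> tree_tableaux T N \<mu>"
proof -
  let ?s = "transpose x y"
  have inj: "inj ?s" by simp
  have im: "set (map ?s (t a)) = ?s ` set (t a)" for a by simp
  have "?s ` set (t a) \<inter> ?s ` set (t b) = {}"
    if "a \<in> nodes T" "b \<in> nodes T" "a \<noteq> b" for a b
    using t that by (simp add: tree_tableaux_def image_Int[OF inj, symmetric])
  moreover have "(\<Union>a\<in>nodes T. ?s ` set (t a)) = {1..N}"
  proof -
    have "(\<Union>a\<in>nodes T. ?s ` set (t a)) = ?s ` (\<Union>a\<in>nodes T. set (t a))" by blast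
    also have "\<dots> = ?s ` {1..N}" using t by (simp add: tree_tableaux_def)
    also have "\<dots> = {1..N}" using permutes_swap_id[OF xy] by (rule permutes_image)
    finally show ?thesis .
  qed
  ultimately show ?thesis
    using t by (simp add: tree_tableaux_def permute_entries_def distinct_map inj_on_subset[OF inj])
qed

lemma entries_subset:
  assumes "t \<in> tree_tableaux T N \<mu>" "a \<in> nodes T"
  shows "set (t a) \<subseteq> {1..N}"
  using assms unfolding tree_tableaux_def by blast

lemma basis_vec_closed:
  "t \<in> tree_tableaux T N \<mu> \<Longrightarrow> basis_vec t \<in> carrier (tableau_module T N \<mu>)"
  by (auto simp: tableau_module_def free_perm_module_def basis_vec_def)

lemma module_tableau_module: "Module.module complex_field (tableau_module T N \<mu>)"
  unfolding tableau_module_def by (rule module_free_perm_module)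

lemma submodule_column_relations:
  "submodule (column_relations T N \<mu>) complex_field (tableau_module T N \<mu>)"
proof -
  interpret Module.module complex_field "tableau_module T N \<mu>"
    by (rule module_tableau_module)
  show ?thesis
    unfolding column_relations_def
  proof (rule submodule_submodule_span[OF module_tableau_module], clarify)
    fix t a x y
    assume t: "t \<in> tree_tableaux T N \<mu>" "a \<in> nodes T" "x \<in> set (t a)" "y \<in> set (t a)"
    then have "switch_entries x y t \<in> tree_tableaux T N \<mu>"
      using entries_subset by (intro switch_entries_tree_tableaux) blast+
    with t show "basis_vec t \<oplus>\<^bsub>tableau_module T N \<mu>\<^esub> basis_vec (switch_entries x y t)
        \<in> carrier (tableau_module T N \<mu>)"
      by (intro M.a_closed basis_vec_closed)
  qed
qed

lemma module_M_module: "Module.module complex_field (M_module T N \<mu>)"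
  unfolding M_module_def
  by (rule module_quotient_module[OF module_tableau_module submodule_column_relations])

lemma tableau_class_closed:
  assumes "t \<in> tree_tableaux T N \<mu>"
  shows "tableau_class T N \<mu> t \<in> carrier (M_module T N \<mu>)"
  using basis_vec_closed[OF assms]
  by (auto simp: tableau_class_def M_module_def quotient_module_def A_RCOSETS_def')

lemma submodule_G_tilde: "submodule (G_tilde T N \<mu>) complex_field (M_module T N \<mu>)"
proof -
  interpret Module.module complex_field "M_module T N \<mu>"
    by (rule module_M_module)
  show ?thesis
    unfolding G_tilde_def
  proof (rule submodule_submodule_span[OF module_M_module], clarify)
    fix a t
    assume a: "a \<in> internal_nodes T" and t: "t \<in> tree_tableaux T N \<mu>"
    have "tableau_class T N \<mu> (switch_entries (fst p) (snd p) t) \<in> carrier (M_module T N \<mu>)"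
      if "p \<in> set (t a) \<times> (\<Union>b \<in> descendants T a. set (t b))" for p
    proof (intro tableau_class_closed switch_entries_tree_tableaux t)
      show "fst p \<in> {1..N}"
        using that a entries_subset[OF t, of a] by (auto simp: internal_nodes_def)
      show "snd p \<in> {1..N}"
        using that entries_subset[OF t] by (fastforce simp: descendants_def)
    qed
    then show "garnir_second T N \<mu> a t \<in> carrier (M_module T N \<mu>)"
      unfolding garnir_second_def
      by (intro M.minus_closed smult_closed M.finsum_closed tableau_class_closed t) auto
  qed
qed

lemma module_S_tilde: "Module.module complex_field (S_tilde T N \<mu>)"
  unfolding S_tilde_def
  by (rule module_quotient_module[OF module_M_module submodule_G_tilde])

section \<open>Young diagrams and Specht modules\<close>

definition is_partition :: "nat \<Rightarrow> nat list \<Rightarrow> bool" where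
  "is_partition N lam \<longleftrightarrow> sorted_wrt (\<ge>) lam \<and> 0 \<notin> set lam \<and> sum_list lam = N"

text \<open>Cells are pairs (row, column), counted from 0; the parts of \<open>lam\<close> are row lengths.\<close>

definition young_diagram :: "nat list \<Rightarrow> (nat \<times> nat) set" where
  "young_diagram lam = {(i, j). i < length lam \<and> j < lam ! i}"

definition num_columns :: "nat list \<Rightarrow> nat" where
  "num_columns lam = card (snd ` young_diagram lam)"

definition column_length :: "nat list \<Rightarrow> nat \<Rightarrow> nat" where
  "column_length lam j = card {i. (i, j) \<in> young_diagram lam}"

definition young_tableaux :: "nat \<Rightarrow> nat list \<Rightarrow> (nat \<times> nat \<Rightarrow> nat) set" where
  "young_tableaux N lam = {t. bij_betw t (young_diagram lam) {1..N}}"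

text \<open>A tabloid is encoded as the function sending each row index to the set of its entries.\<close>

definition tabloid :: "nat list \<Rightarrow> (nat \<times> nat \<Rightarrow> nat) \<Rightarrow> nat \<Rightarrow> nat set" where
  "tabloid lam t = (\<lambda>i. {t (i, j) | j. (i, j) \<in> young_diagram lam})"

definition tabloid_module :: "nat \<Rightarrow> nat list \<Rightarrow> ((nat \<Rightarrow> nat set) \<Rightarrow> complex) perm_module" where
  "tabloid_module N lam =
    free_perm_module (\<lambda>\<sigma> R i. \<sigma> ` R i) (tabloid lam ` young_tableaux N lam)"

definition column_stabilizer ::
    "nat \<Rightarrow> nat list \<Rightarrow> (nat \<times> nat \<Rightarrow> nat) \<Rightarrow> (nat \<Rightarrow> nat) set" where
  "column_stabilizer N lam t =
    {\<sigma> \<in> carrier (sym_group N).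
       \<forall>j. \<sigma> ` {t (i, j) | i. (i, j) \<in> young_diagram lam} = {t (i, j) | i. (i, j) \<in> young_diagram lam}}"

definition polytabloid ::
    "nat \<Rightarrow> nat list \<Rightarrow> (nat \<times> nat \<Rightarrow> nat) \<Rightarrow> (nat \<Rightarrow> nat set) \<Rightarrow> complex" where
  "polytabloid N lam t =
    (\<Oplus>\<^bsub>tabloid_module N lam\<^esub> \<sigma> \<in> column_stabilizer N lam t.
       of_int (sign \<sigma>) \<odot>\<^bsub>tabloid_module N lam\<^esub> basis_vec (tabloid lam (\<sigma> \<circ> t)))"

definition specht_module :: "nat \<Rightarrow> nat list \<Rightarrow> ((nat \<Rightarrow> nat set) \<Rightarrow> complex) perm_module" where
  "specht_module N lam =
    (tabloid_module N lam)
      \<lparr>carrier := submodule_span (tabloid_module N lam) (polytabloid N lam ` young_tableaux N lam)\<rparr>"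

end

theory Submission
  imports Defs "HOL-Library.Function_Algebras"
begin

text \<open>
  Only the Garnir relations at the root are needed.  A copy of \<open>S\<^sup>\<lambda>\<close> in the quotient
  is detected by linear functionals on the tableau module that satisfy these relations; averaging
  over the row or the column group of a Young tableau \<open>t\<close> yields nonzero functionals that are
  invariant under row permutations of \<open>t\<close>, respectively alternating under its column permutations.

  In a tableau supporting a row-invariant functional, no column contains two entries of one row of
  \<open>t\<close>.  By pigeonhole the rows of \<open>\<lambda>\<close> have length at most \<open>n = |T|\<close>, and
  every row of length \<open>n\<close> meets the root column, so there are at most \<open>\<mu>(r)\<close> of
  them.

  For the reverse inequality, positivity turns the relations of the second kind into those of the
  first kind, \<open>g(s) = \<Sum> g((x y) s)\<close> over the entries \<open>y\<close> of a fixed column, for each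
  \<open>x\<close> in the root column.  If \<open>g\<close> is column-alternating and the last column of
  \<open>t\<close> were shorter than \<open>\<mu>(r)\<close>, an extremal tableau in the support of \<open>g\<close>
  has an entry \<open>x\<close> in the root column for which every term on the right is \<open>0\<close> or
  \<open>-g(s)\<close>, which forces \<open>g(s) = 0\<close>.
\<close>

section \<open>Exchanging entries of tree tableaux\<close>

lemma permute_entries_comp:
  "permute_entries (\<sigma> \<circ> \<tau>) t = permute_entries \<sigma> (permute_entries \<tau> t)"
  by (simp add: permute_entries_def comp_def)

lemma switch_switch [simp]: "switch_entries x y (switch_entries x y t) = t"
  by (simp add: permute_entries_def comp_def)

lemma switch_entries_commute: "switch_entries x y t = switch_entries y x t"
  by (simp add: transpose_commute)

lemma permute_switch_entries:
  assumes "bij \<sigma>"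
  shows "permute_entries \<sigma> (switch_entries x y t) =
    switch_entries (\<sigma> x) (\<sigma> y) (permute_entries \<sigma> t)"
proof -
  have "\<sigma> \<circ> transpose x y = transpose (\<sigma> x) (\<sigma> y) \<circ> \<sigma>"
    using bij_is_inj[OF assms] by (auto simp: fun_eq_iff transpose_def inj_eq)
  then show ?thesis by (simp add: permute_entries_comp [symmetric])
qed

lemma permute_entries_tree_tableaux:
  assumes t: "t \<in> tree_tableaux T N \<mu>" and \<sigma>: "\<sigma> permutes {1..N}"
  shows "permute_entries \<sigma> t \<in> tree_tableaux T N \<mu>"
proof -
  have inj: "inj \<sigma>" using \<sigma> by (rule permutes_inj)
  have "\<sigma> ` set (t a) \<inter> \<sigma> ` set (t b) = {}"
    if "a \<in> nodes T" "b \<in> nodes T" "a \<noteq> b" for a b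
    using t that by (simp add: tree_tableaux_def image_Int[OF inj, symmetric])
  moreover have "(\<Union>a\<in>nodes T. \<sigma> ` set (t a)) = {1..N}"
  proof -
    have "(\<Union>a\<in>nodes T. \<sigma> ` set (t a)) = \<sigma> ` (\<Union>a\<in>nodes T. set (t a))" by blast
    then show ?thesis using t permutes_image[OF \<sigma>] by (simp add: tree_tableaux_def)
  qed
  ultimately show ?thesis
    using t by (simp add: tree_tableaux_def permute_entries_def distinct_map inj_on_subset[OF inj])
qed

lemma tableau_entries_disjoint:
  assumes "t \<in> tree_tableaux T N \<mu>" "x \<in> set (t a)" "x \<in> set (t b)"
  shows "a = b"
proof -
  have "a \<in> nodes T" "b \<in> nodes T"
    using assms by (auto simp: tree_tableaux_def)
  then show ?thesis using assms unfolding tree_tableaux_def by blast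
qed

lemma set_switch_entries: "set (switch_entries x y t a) = transpose x y ` set (t a)"
  by (simp add: permute_entries_def)

lemma finite_tree_tableaux: "finite (tree_tableaux T N \<mu>)"
proof (rule finite_subset)
  \<comment> \<open>The sum of all labels is one bound valid for every column length, which gives a
    single finite codomain for all nodes at once.\<close>
  let ?L = "{xs. set xs \<subseteq> {1..N} \<and> length xs \<le> (\<Sum>a\<in>nodes T. \<mu> a)}"
  show "tree_tableaux T N \<mu> \<subseteq>
      {t. \<forall>a. (a \<in> nodes T \<longrightarrow> t a \<in> ?L) \<and> (a \<notin> nodes T \<longrightarrow> t a = [])}"
    using finite_nodes by (auto simp: tree_tableaux_def intro!: member_le_sum)
  show "finite {t. \<forall>a. (a \<in> nodes T \<longrightarrow> t a \<in> ?L) \<and> (a \<notin> nodes T \<longrightarrow> t a = [])}"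
    by (intro finite_set_of_finite_funs finite_nodes finite_lists_length_le) simp
qed

text \<open>
  These are the linear functionals on the tableau module that kill the column relations and the
  Garnir relations at the root, given by their values on the basis.
\<close>

definition garnir_functional ::
    "plane_tree \<Rightarrow> nat \<Rightarrow> (nat list \<Rightarrow> nat) \<Rightarrow> ((nat list \<Rightarrow> nat list) \<Rightarrow> complex) \<Rightarrow> bool" where
  "garnir_functional T N \<mu> g \<longleftrightarrow>
    (\<forall>t \<in> tree_tableaux T N \<mu>. \<forall>a. \<forall>x \<in> set (t a). \<forall>y \<in> set (t a).
       x \<noteq> y \<longrightarrow> g (switch_entries x y t) = - g t) \<and>
    (\<forall>t \<in> tree_tableaux T N \<mu>.
       of_nat (card (nodes T - {[]}) * \<mu> []) * g t =
       (\<Sum>p \<in> set (t []) \<times> (\<Union>b \<in> nodes T - {[]}. set (t b)).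
          g (switch_entries (fst p) (snd p) t)))"

lemma garnir_functional_switch:
  assumes "garnir_functional T N \<mu> g" "t \<in> tree_tableaux T N \<mu>"
    "x \<in> set (t a)" "y \<in> set (t a)" "x \<noteq> y"
  shows "g (switch_entries x y t) = - g t"
  using assms unfolding garnir_functional_def by blast

lemma root_node [simp]: "[] \<in> nodes T"
  by (simp add: nodes_def is_node.root)

lemma nodes_nonempty [simp]: "nodes T \<noteq> {}"
  using root_node by blast

lemma switch_in_tree_tableaux:
  assumes "t \<in> tree_tableaux T N \<mu>" "x \<in> set (t a)" "y \<in> set (t b)"
  shows "switch_entries x y t \<in> tree_tableaux T N \<mu>"
proof -
  have "a \<in> nodes T" "b \<in> nodes T"
    using assms by (auto simp: tree_tableaux_def)
  then show ?thesis
    using assms entries_subset[OF assms(1)] by (intro switch_entries_tree_tableaux) blast+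
qed

lemma set_switch_left:
  assumes t: "t \<in> tree_tableaux T N \<mu>" and x: "x \<in> set (t a)" and y: "y \<in> set (t b)" and ab: "a \<noteq> b"
  shows "set (switch_entries x y t a) = insert y (set (t a) - {x})"
proof -
  have "y \<notin> set (t a)" using tableau_entries_disjoint[OF t _ y] ab by blast
  then show ?thesis using x unfolding set_switch_entries
    by (auto simp: transpose_def image_iff)
qed

lemma set_switch_right:
  assumes t: "t \<in> tree_tableaux T N \<mu>" and x: "x \<in> set (t a)" and y: "y \<in> set (t b)" and ab: "a \<noteq> b"
  shows "set (switch_entries x y t b) = insert x (set (t b) - {y})"
  using set_switch_left[OF t y x] ab by (simp add: switch_entries_commute)

section \<open>Exchange defects and relations of the first kind\<close>

text \<open>The amount by which \<open>g\<close> violates the Garnir relation of the first kind, in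
  which the single entry \<open>x\<close> is exchanged with each entry of the column of
  \<open>b\<close> in turn.\<close>

definition exchange_defect ::
    "((nat list \<Rightarrow> nat list) \<Rightarrow> complex) \<Rightarrow> nat list \<Rightarrow> (nat list \<Rightarrow> nat list) \<Rightarrow> nat \<Rightarrow> complex" where
  "exchange_defect g b t x = g t - (\<Sum>y\<in>set (t b). g (switch_entries x y t))"

text \<open>For \<open>g\<close> alternating in the column of \<open>b\<close>, the defect is, up to
  a nonzero factor, the alternation of \<open>g\<close> over that column enlarged by
  \<open>y\<close>. It is therefore alternating on the enlarged set, which contains
  \<open>x\<close>. In the computation, the term exchanging \<open>x\<close> with \<open>y\<close>
  returns \<open>g t\<close>, and the other terms change sign by a column relation.\<close>

lemma exchange_defect_switch:
  assumes g: "garnir_functional T N \<mu> g" and t: "t \<in> tree_tableaux T N \<mu>"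
    and b: "b \<noteq> a" and y: "y \<in> set (t a)" and x: "x \<in> set (t b)"
  shows "exchange_defect g b (switch_entries x y t) x = - exchange_defect g b t y"
proof -
  let ?R = "set (t b) - {x}"
  have yb: "y \<notin> set (t b)" using tableau_entries_disjoint[OF t _ y] b by blast
  have xy: "x \<noteq> y" using x yb by blast
  have set: "set (switch_entries x y t b) = insert y ?R"
    using set_switch_left[OF t x y] b by simp
  have 3: "g (switch_entries x z (switch_entries x y t)) = - g (switch_entries y z t)"
    if z: "z \<in> ?R" for z
  proof -
    \<comment> \<open>The product is rewritten so that the outer transposition acts on a tableau
      whose column at \<open>b\<close> contains both \<open>x\<close> and \<open>y\<close>; there it
      only contributes a sign.\<close>
    have "switch_entries x z (switch_entries x y t) = switch_entries x y (switch_entries y z t)"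
    proof -
      have "transpose x z \<circ> transpose x y = transpose x y \<circ> transpose y z"
        using z xy yb by (auto simp: fun_eq_iff transpose_def)
      then show ?thesis by (simp add: permute_entries_comp [symmetric])
    qed
    moreover have "set (switch_entries y z t b) = insert y (set (t b) - {z})"
      using z b y set_switch_right[OF t y, of z b] by blast
    then have "x \<in> set (switch_entries y z t b)" "y \<in> set (switch_entries y z t b)"
      using x z by auto
    moreover have "switch_entries y z t \<in> tree_tableaux T N \<mu>"
      using z by (intro switch_in_tree_tableaux[OF t y, of _ b]) auto
    ultimately show ?thesis
      using garnir_functional_switch[OF g _ _ _ xy] by metis
  qed
  have "exchange_defect g b (switch_entries x y t) x =
      g (switch_entries x y t) - (g t + (\<Sum>z\<in>?R. g (switch_entries x z (switch_entries x y t))))"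
    using yb unfolding exchange_defect_def set by simp
  also have "\<dots> = g (switch_entries x y t) - (g t - (\<Sum>z\<in>?R. g (switch_entries y z t)))"
    using 3 by (simp add: sum_negf)
  also have "\<dots> = - exchange_defect g b t y"
    using x by (simp add: exchange_defect_def sum.remove[of "set (t b)" x] switch_entries_commute[of x y])
  finally show ?thesis .
qed

text \<open>The operator sending \<open>g\<close> to its defect is self-adjoint and is
  \<open>1 + \<mu> b\<close> times a projection. Concretely, one factor of the squared norm is
  expanded. The terms with an exchanged tableau are then reindexed, the defect changes sign, and
  each of the \<open>\<mu> b\<close> exchanges gives back one more copy of the term with
  \<open>g t\<close>.\<close>

lemma sum_norm_exchange_defect:
  assumes g: "garnir_functional T N \<mu> g" and b: "b \<in> nodes T" "b \<noteq> []"
  shows "(\<Sum>t\<in>tree_tableaux T N \<mu>. \<Sum>x\<in>set (t []). of_real ((cmod (exchange_defect g b t x))\<^sup>2)) =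
    (1 + of_nat (\<mu> b)) *
    (\<Sum>t\<in>tree_tableaux T N \<mu>. \<Sum>x\<in>set (t []). cnj (g t) * exchange_defect g b t x)"
proof -
  let ?B = "tree_tableaux T N \<mu>" and ?h = "exchange_defect g b"
  let ?S = "\<lambda>F. \<Sum>t\<in>?B. \<Sum>x\<in>set (t []). F t x"
  define P where "P = (SIGMA t:?B. set (t []) \<times> set (t b))"
  \<comment> \<open>An involution on triples: after the exchange \<open>y\<close> sits in the root
    column and \<open>x\<close> in the column of \<open>b\<close>, so the two entries trade their
    roles.\<close>
  define swap where "swap = (\<lambda>(t, x, y). (switch_entries x y t, y, x) :: (nat list \<Rightarrow> nat list) \<times> nat \<times> nat)"
  have finB: "finite ?B" by (rule finite_tree_tableaux)
  have P_sum: "?S (\<lambda>t x. \<Sum>y\<in>set (t b). F t x y) = (\<Sum>(t, x, y)\<in>P. F t x y)" for F :: "_ \<Rightarrow> _ \<Rightarrow> _ \<Rightarrow> complex"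
    unfolding P_def using finB by (simp add: sum.Sigma sum.cartesian_product split_def)
  have swap_P: "swap p \<in> P" "swap (swap p) = p" if P: "p \<in> P" for p
  proof -
    obtain t x y where p: "p = (t, x, y)" "t \<in> ?B" "x \<in> set (t [])" "y \<in> set (t b)"
      using P by (cases p rule: prod_cases3) (simp add: P_def)
    show "swap (swap p) = p"
      by (simp add: p swap_def switch_entries_commute[of y x])
    show "swap p \<in> P"
      using p(2-4) b(2) set_switch_left[OF p(2-4)] set_switch_right[OF p(2-4)]
        switch_in_tree_tableaux[OF p(2-4)]
      by (simp add: p(1) swap_def P_def)
  qed
  have "(\<Sum>(t, x, y)\<in>P. cnj (g (switch_entries x y t)) * ?h t x) =
      (\<Sum>(t, x, y)\<in>P. - (cnj (g t) * ?h t x))"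
  proof (rule sum.reindex_bij_witness[of P swap swap])
    fix p assume "p \<in> P"
    then obtain t x y where p: "p = (t, x, y)" "t \<in> ?B" "x \<in> set (t [])" "y \<in> set (t b)"
      by (cases p rule: prod_cases3) (simp add: P_def)
    let ?s = "switch_entries x y t"
    have "?s \<in> ?B" "y \<in> set (?s [])" "x \<in> set (?s b)"
      using p(2-4) b(2) set_switch_left[OF p(2-4)] set_switch_right[OF p(2-4)]
        switch_in_tree_tableaux[OF p(2-4)] by auto
    from exchange_defect_switch[OF g this(1) b(2) this(2,3)]
    have "?h t x = - ?h ?s y" by simp
    then show "(case swap p of (t, x, y) \<Rightarrow> - (cnj (g t) * ?h t x)) =
        (case p of (t, x, y) \<Rightarrow> cnj (g (switch_entries x y t)) * ?h t x)"
      by (simp add: p(1) swap_def)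
  qed (use swap_P in auto)
  also have "\<dots> = ?S (\<lambda>t x. \<Sum>y\<in>set (t b). - (cnj (g t) * ?h t x))"
    by (simp only: P_sum)
  also have "\<dots> = ?S (\<lambda>t x. - (of_nat (\<mu> b) * (cnj (g t) * ?h t x)))"
    using b by (intro sum.cong refl) (auto simp: tree_tableaux_def distinct_card)
  also have "\<dots> = - (of_nat (\<mu> b) * ?S (\<lambda>t x. cnj (g t) * ?h t x))"
    by (simp add: sum_negf sum_distrib_left)
  finally have swap_sum: "(\<Sum>(t, x, y)\<in>P. cnj (g (switch_entries x y t)) * ?h t x) =
      - (of_nat (\<mu> b) * ?S (\<lambda>t x. cnj (g t) * ?h t x))" .
  \<comment> \<open>Only the conjugated factor of the squared norm is unfolded; the other one stays
    a defect, so that its sign change under \<open>swap\<close> can be used.\<close>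
  have "?S (\<lambda>t x. of_real ((cmod (?h t x))\<^sup>2)) =
      ?S (\<lambda>t x. cnj (g t) * ?h t x - (\<Sum>y\<in>set (t b). cnj (g (switch_entries x y t)) * ?h t x))"
    by (intro sum.cong refl, subst complex_norm_square, subst (2) exchange_defect_def)
      (simp add: algebra_simps sum_distrib_left)
  also have "\<dots> = ?S (\<lambda>t x. cnj (g t) * ?h t x) + of_nat (\<mu> b) * ?S (\<lambda>t x. cnj (g t) * ?h t x)"
    by (simp only: sum_subtractf P_sum swap_sum) simp
  finally show ?thesis by (simp add: algebra_simps)
qed

text \<open>
  Summed against the conjugate of \<open>g\<close>, the relations of the second kind become a
  positive combination of the squared norms of all exchange defects, so that each defect vanishes.
\<close>

lemma garnir_first_kind:
  assumes g: "garnir_functional T N \<mu> g" and t: "t \<in> tree_tableaux T N \<mu>"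
    and b: "b \<in> nodes T" "b \<noteq> []" and x: "x \<in> set (t [])"
  shows "g t = (\<Sum>y\<in>set (t b). g (switch_entries x y t))"
proof -
  let ?B = "tree_tableaux T N \<mu>" and ?D = "nodes T - {[]}"
  let ?Q = "\<lambda>b. \<Sum>t\<in>?B. \<Sum>x\<in>set (t []). (cmod (exchange_defect g b t x))\<^sup>2"
  have fin: "finite ?B" "finite ?D" by (auto simp: finite_tree_tableaux finite_nodes)
  \<comment> \<open>This is the relation of the second kind at the root: the pairs of a non-root
    node and a root entry number \<open>card ?D * \<mu> []\<close>, which is exactly its
    coefficient.\<close>
  have total: "(\<Sum>b\<in>?D. \<Sum>x\<in>set (s []). exchange_defect g b s x) = 0" if s: "s \<in> ?B" for s
  proof -
    have un: "(\<Sum>y\<in>(\<Union>b\<in>?D. set (s b)). F y) = (\<Sum>b\<in>?D. \<Sum>y\<in>set (s b). F y)"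
      for F :: "nat \<Rightarrow> complex"
      using fin s by (intro sum.UNION_disjoint) (auto simp: tree_tableaux_def)
    have "(\<Sum>b\<in>?D. \<Sum>x\<in>set (s []). \<Sum>y\<in>set (s b). g (switch_entries x y s)) =
        (\<Sum>x\<in>set (s []). \<Sum>y\<in>(\<Union>b\<in>?D. set (s b)). g (switch_entries x y s))"
      by (subst sum.swap) (simp only: un)
    also have "\<dots> = of_nat (card ?D * \<mu> []) * g s"
      using g s unfolding garnir_functional_def by (simp add: sum.cartesian_product split_def)
    moreover have "card (set (s [])) = \<mu> []"
      using s by (simp add: tree_tableaux_def distinct_card)
    ultimately show ?thesis
      by (simp add: exchange_defect_def sum_subtractf)
  qed
  \<comment> \<open>The factor \<open>1 + \<mu> b\<close> depends on the node, so it is divided out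
    before summing. The weights stay positive, and a vanishing total forces every summand to
    vanish.\<close>
  have "(\<Sum>b\<in>?D. complex_of_real (?Q b / (1 + real (\<mu> b)))) =
      (\<Sum>b\<in>?D. \<Sum>t\<in>?B. \<Sum>x\<in>set (t []). cnj (g t) * exchange_defect g b t x)"
  proof (intro sum.cong refl)
    fix b assume "b \<in> ?D"
    moreover have "1 + complex_of_nat (\<mu> b) \<noteq> 0"
      using of_nat_neq_0[of "\<mu> b", where 'a = complex] by simp
    ultimately show "complex_of_real (?Q b / (1 + real (\<mu> b))) =
        (\<Sum>t\<in>?B. \<Sum>x\<in>set (t []). cnj (g t) * exchange_defect g b t x)"
      using sum_norm_exchange_defect[OF g, of b] by (simp del: of_real_power)
  qed
  also have "\<dots> = (\<Sum>t\<in>?B. cnj (g t) * (\<Sum>b\<in>?D. \<Sum>x\<in>set (t []). exchange_defect g b t x))"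
    by (subst sum.swap) (simp add: sum_distrib_left)
  also have "\<dots> = 0" using total by simp
  finally have "(\<Sum>b\<in>?D. ?Q b / (1 + real (\<mu> b))) = 0"
    by (simp only: of_real_sum [symmetric] of_real_eq_0_iff)
  then have "?Q b / (1 + real (\<mu> b)) = 0"
    using fin(2) b by (subst (asm) sum_nonneg_eq_0_iff) (auto intro!: sum_nonneg divide_nonneg_nonneg)
  then have "?Q b = 0" by simp
  then have "(\<Sum>x\<in>set (t []). (cmod (exchange_defect g b t x))\<^sup>2) = 0"
    using fin(1) t by (subst (asm) sum_nonneg_eq_0_iff) (auto intro!: sum_nonneg)
  then have "(cmod (exchange_defect g b t x))\<^sup>2 = 0"
    using x by (subst (asm) sum_nonneg_eq_0_iff) auto
  then show ?thesis by (simp add: exchange_defect_def)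
qed

section \<open>Constraints on the shape\<close>

definition column_set :: "nat list \<Rightarrow> (nat \<times> nat \<Rightarrow> nat) \<Rightarrow> nat \<Rightarrow> nat set" where
  "column_set lam t j = {t (i, j) | i. (i, j) \<in> young_diagram lam}"

lemma row_length_bound:
  assumes g: "garnir_functional T N \<mu> g" and s: "s \<in> tree_tableaux T N \<mu>" "g s \<noteq> 0"
    and t: "t \<in> young_tableaux N lam"
    and inv: "\<And>x y i. x \<in> tabloid lam t i \<Longrightarrow> y \<in> tabloid lam t i \<Longrightarrow> g (switch_entries x y s) = g s"
  shows "\<And>i. i < length lam \<Longrightarrow> lam ! i \<le> card (nodes T)"
    and "card {i. (i, card (nodes T) - 1) \<in> young_diagram lam} \<le> \<mu> []"
proof -
  have inj: "inj_on t (young_diagram lam)" and im: "t ` young_diagram lam = {1..N}"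
    using t by (auto simp: young_tableaux_def bij_betw_def)
  have un: "(\<Union>a \<in> nodes T. set (s a)) = {1..N}"
    using s(1) by (auto simp: tree_tableaux_def)
  have "\<forall>p \<in> young_diagram lam. \<exists>a \<in> nodes T. t p \<in> set (s a)"
    using im un by blast
  \<comment> \<open>\<open>c p\<close> is the node of the tree whose column in \<open>s\<close>
    holds the entry of cell \<open>p\<close>.\<close>
  then obtain c where c: "\<And>p. p \<in> young_diagram lam \<Longrightarrow> c p \<in> nodes T"
      "\<And>p. p \<in> young_diagram lam \<Longrightarrow> t p \<in> set (s (c p))"
    by metis
  \<comment> \<open>Two entries of one row of \<open>t\<close> in one column of \<open>s\<close>
    would give \<open>g s = - g s\<close>: row invariance fixes the value and the column relation
    negates it.\<close>
  have c_inj: "j = k"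
    if "(i, j) \<in> young_diagram lam" "(i, k) \<in> young_diagram lam" "c (i, j) = c (i, k)" for i j k
  proof (rule ccontr)
    assume "j \<noteq> k"
    then have "t (i, j) \<noteq> t (i, k)" using inj that by (auto dest: inj_onD)
    then have "g (switch_entries (t (i, j)) (t (i, k)) s) = - g s"
      using that c by (intro garnir_functional_switch[OF g s(1), of _ "c (i, j)"]) force+
    moreover have "g (switch_entries (t (i, j)) (t (i, k)) s) = g s"
      using that by (intro inv[of _ i]) (auto simp: tabloid_def)
    ultimately show False using s(2) by (simp add: equation_minus_iff)
  qed
  have row: "inj_on (\<lambda>j. c (i, j)) {..<lam ! i}" "(\<lambda>j. c (i, j)) ` {..<lam ! i} \<subseteq> nodes T"
    if "i < length lam" for i
    using that c_inj[of i] c(1) by (auto simp: young_diagram_def intro!: inj_onI)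
  show len: "lam ! i \<le> card (nodes T)" if "i < length lam" for i
    using card_inj_on_le[OF row[OF that] finite_nodes] by simp
  \<comment> \<open>Columns are counted from 0, so \<open>I\<close> consists of the rows of length
    at least \<open>card (nodes T)\<close>. By \<open>len\<close> they have exactly this length, and
    \<open>c\<close> maps each of them onto all nodes, the root included.\<close>
  define I where "I = {i. (i, card (nodes T) - 1) \<in> young_diagram lam}"
  have pos: "0 < card (nodes T)"
    by (simp add: card_gt_0_iff finite_nodes)
  have "\<exists>j. (i, j) \<in> young_diagram lam \<and> c (i, j) = []" if "i \<in> I" for i
  proof -
    have i: "i < length lam" "card (nodes T) \<le> lam ! i"
      using that pos by (auto simp: I_def young_diagram_def)
    then have "(\<lambda>j. c (i, j)) ` {..<lam ! i} = nodes T"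
      using row[OF i(1)] finite_nodes by (intro card_subset_eq) (auto simp: card_image intro: antisym len)
    then have "[] \<in> (\<lambda>j. c (i, j)) ` {..<lam ! i}" by simp
    then obtain j where "j < lam ! i" "c (i, j) = []" by auto
    then show ?thesis using i by (auto simp: young_diagram_def)
  qed
  \<comment> \<open>In row \<open>i\<close> the cell \<open>(i, d i)\<close> carries an entry of the
    root column. Different rows give different entries, so \<open>I\<close> injects into that
    column.\<close>
  then obtain d where d: "\<And>i. i \<in> I \<Longrightarrow> (i, d i) \<in> young_diagram lam" "\<And>i. i \<in> I \<Longrightarrow> c (i, d i) = []"
    by metis
  have "inj_on (\<lambda>i. t (i, d i)) I"
    using d(1) inj by (auto simp: inj_on_def)
  moreover have "(\<lambda>i. t (i, d i)) ` I \<subseteq> set (s [])"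
    using d c(2) by fastforce
  ultimately have "card I \<le> card (set (s []))"
    by (rule card_inj_on_le) simp
  then show "card {i. (i, card (nodes T) - 1) \<in> young_diagram lam} \<le> \<mu> []"
    using s(1) by (simp add: I_def tree_tableaux_def distinct_card)
qed

text \<open>If the last column of \<open>t\<close> were too short, the root column of an extremal
  \<open>q\<close> would contain some \<open>x\<close> outside it. Exchanging \<open>x\<close> with
  any entry of the node paired with its column either improves on \<open>q\<close>, so that
  \<open>g\<close> vanishes there, or switches two entries of one column of \<open>t\<close>. The
  relation of the first kind then equates \<open>g q\<close> with a nonpositive integer multiple of
  itself.\<close>

lemma root_label_le_last_column:
  assumes g: "garnir_functional T N \<mu> g" and s: "s \<in> tree_tableaux T N \<mu>" "g s \<noteq> 0"
    and t: "t \<in> young_tableaux N lam"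
    and len: "\<And>i. i < length lam \<Longrightarrow> lam ! i \<le> card (nodes T)"
    and anti: "\<And>x y j s. s \<in> tree_tableaux T N \<mu> \<Longrightarrow> x \<in> column_set lam t j \<Longrightarrow>
      y \<in> column_set lam t j \<Longrightarrow> x \<noteq> y \<Longrightarrow> g (switch_entries x y s) = - g s"
  shows "\<mu> [] \<le> card {i. (i, card (nodes T) - 1) \<in> young_diagram lam}"
proof (rule ccontr)
  let ?B = "tree_tableaux T N \<mu>"
  define n where "n = card (nodes T) - 1"
  \<comment> \<open>The entries of \<open>t\<close> in the last column allowed by
    \<open>len\<close>; at this point \<open>K\<close> may be empty.\<close>
  define K where "K = column_set lam t n"
  assume "\<not> ?thesis"
  then have less: "card {i. (i, n) \<in> young_diagram lam} < \<mu> []" by (simp add: n_def)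
  have inj: "inj_on t (young_diagram lam)" and im: "t ` young_diagram lam = {1..N}"
    using t by (auto simp: young_tableaux_def bij_betw_def)
  have finI: "finite {i. (i, n) \<in> young_diagram lam}"
    by (rule finite_subset[of _ "{..<length lam}"]) (auto simp: young_diagram_def)
  have K: "finite K" "card K < \<mu> []"
  proof -
    have "K = (\<lambda>i. t (i, n)) ` {i. (i, n) \<in> young_diagram lam}"
      by (auto simp: K_def column_set_def)
    then show "finite K" "card K < \<mu> []"
      using finI less card_image_le[OF finI, of "\<lambda>i. t (i, n)"] by auto
  qed
  have "\<forall>x \<in> {1..N}. \<exists>j. x \<in> column_set lam t j"
    unfolding im[symmetric] column_set_def by force
  \<comment> \<open>\<open>\<beta> x\<close> is the column of \<open>t\<close> that contains
    \<open>x\<close>. Outside \<open>K\<close> it is less than \<open>n\<close>, so the pairing of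
    columns with non-root nodes applies.\<close>
  then obtain \<beta> where \<beta>: "\<And>x. x \<in> {1..N} \<Longrightarrow> x \<in> column_set lam t (\<beta> x)"
    by metis
  have \<beta>_less: "\<beta> x < n" if "x \<in> {1..N} - K" for x
  proof -
    have x: "x \<in> column_set lam t (\<beta> x)" using that \<beta> by blast
    then obtain i where "i < length lam" "\<beta> x < lam ! i"
      by (auto simp: column_set_def young_diagram_def)
    then have "\<beta> x \<le> n" using len[of i] by (simp add: n_def)
    moreover have "\<beta> x \<noteq> n" using x that by (auto simp: K_def)
    ultimately show ?thesis by simp
  qed
  have "card (nodes T - {[]}) = n" by (simp add: n_def finite_nodes)
  then obtain b where b: "bij_betw b {..<n} (nodes T - {[]})"
    using ex_bij_betw_nat_finite[of "nodes T - {[]}"] finite_nodes by (auto simp: atLeast0LessThan)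
  have b_node: "b j \<in> nodes T" "b j \<noteq> []" if "j < n" for j
    using b that by (auto simp: bij_betw_def)
  have b_eq: "i = j" if "i < n" "j < n" "b i = b j" for i j
    using b that by (auto simp: bij_betw_def dest: inj_onD)
  txt \<open>
    Column \<open>j < n\<close> of \<open>t\<close> is paired with the node \<open>b j\<close>.  The contradiction
    comes from a tableau \<open>q\<close> in the support of \<open>g\<close> with, first, as many entries of
    \<open>K\<close> in the root column as possible and, second, as many entries as possible lying in the
    node paired with their column.
  \<close>
  define J where "J s = card (set (s []) \<inter> K)" for s :: "nat list \<Rightarrow> nat list"
  define D where "D s = {x \<in> {1..N} - K. x \<in> set (s (b (\<beta> x)))}" for s :: "nat list \<Rightarrow> nat list"
  have J_bound: "J s \<le> card K" for s
    unfolding J_def by (intro card_mono K) auto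
  have D_bound: "card (D s) \<le> N" for s
  proof -
    have "D s \<subseteq> {1..N}" by (auto simp: D_def)
    then show ?thesis using card_mono[of "{1..N}" "D s"] by simp
  qed
  \<comment> \<open>The lexicographic order on the two quantities, coded as one number:
    \<open>card (D s)\<close> is at most \<open>N\<close>, so the weight \<open>N + 1\<close> lets
    \<open>J\<close> decide first.\<close>
  define w where "w s = J s * (N + 1) + card (D s)" for s
  have w_less: "w s < w s'" if "J s < J s' \<or> J s = J s' \<and> card (D s) < card (D s')" for s s'
  proof (cases "J s < J s'")
    case True
    then have "(J s + 1) * (N + 1) \<le> J s' * (N + 1)" by (intro mult_right_mono) auto
    then show ?thesis using D_bound[of s] by (simp add: w_def)
  qed (use that in \<open>auto simp: w_def\<close>)
  have "finite (w ` {s \<in> ?B. g s \<noteq> 0})" using finite_tree_tableaux by simp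
  then obtain q where q: "q \<in> ?B" "g q \<noteq> 0" "\<And>s. s \<in> ?B \<Longrightarrow> g s \<noteq> 0 \<Longrightarrow> w s \<le> w q"
    using Max_in[of "w ` {s \<in> ?B. g s \<noteq> 0}"] Max_ge[of "w ` {s \<in> ?B. g s \<noteq> 0}"] s by fastforce
  have "card (set (q [])) = \<mu> []"
    using q(1) by (simp add: tree_tableaux_def distinct_card)
  then have "\<not> set (q []) \<subseteq> K"
    using K card_mono by (metis leD)
  then obtain x where x: "x \<in> set (q [])" "x \<notin> K" by blast
  have xN: "x \<in> {1..N}" using entries_subset[OF q(1) root_node] x by blast
  define a where "a = b (\<beta> x)"
  have a: "a \<in> nodes T" "a \<noteq> []" using \<beta>_less[of x] b_node xN x by (auto simp: a_def)
  have term_sign: "g (switch_entries x y q) = 0 \<or> g (switch_entries x y q) = - g q" if y: "y \<in> set (q a)" for y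
  proof -
    let ?s = "switch_entries x y q"
    have yN: "y \<in> {1..N}" using entries_subset[OF q(1) a(1)] y by blast
    have y_root: "y \<notin> set (q [])" using tableau_entries_disjoint[OF q(1) y] a by blast
    have xy: "x \<noteq> y" using x y_root by blast
    have sB: "?s \<in> ?B" by (rule switch_in_tree_tableaux[OF q(1) x(1) y])
    have root: "set (?s []) = insert y (set (q []) - {x})"
      using set_switch_left[OF q(1) x(1) y] a by simp
    have zero: "g ?s = 0" if "w q < w ?s"
      using q(3)[OF sB] that by fastforce
    \<comment> \<open>If \<open>y\<close> is in \<open>K\<close>, the exchange brings it into the
      root column and raises \<open>J\<close>. If \<open>y\<close> belongs to another column outside
      \<open>K\<close>, then \<open>J\<close> is unchanged and \<open>x\<close> reaches its paired
      node; \<open>y\<close> was not at its own, since \<open>b\<close> is injective, so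
      \<open>D\<close> grows. If \<open>x\<close> and \<open>y\<close> share a column of
      \<open>t\<close>, alternation gives the sign.\<close>
    consider "y \<in> K" | "y \<notin> K" "\<beta> y \<noteq> \<beta> x" | "\<beta> y = \<beta> x" by blast
    then show ?thesis
    proof cases
      case 1
      have "set (?s []) \<inter> K = insert y (set (q []) \<inter> K)"
        unfolding root using 1 x by auto
      then have "J q < J ?s" using y_root by (simp add: J_def)
      then show ?thesis using zero w_less by blast
    next
      case 2
      have "set (?s []) \<inter> K = set (q []) \<inter> K"
        unfolding root using 2 x by auto
      then have J: "J q = J ?s" by (simp add: J_def)
      have "x \<notin> D q"
        using tableau_entries_disjoint[OF q(1) x(1), of a] a(2) by (auto simp: D_def a_def)
      moreover have "x \<in> D ?s"
        using xN x set_switch_right[OF q(1) x(1) y] a by (simp add: D_def a_def)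
      moreover have "D q \<subseteq> D ?s"
      proof
        fix z assume z: "z \<in> D q"
        then have z': "z \<in> {1..N} - K" "z \<in> set (q (b (\<beta> z)))" by (auto simp: D_def)
        have "z \<noteq> x" using z \<open>x \<notin> D q\<close> by blast
        moreover have "z \<noteq> y"
        proof
          assume "z = y"
          then have "b (\<beta> y) = b (\<beta> x)" using tableau_entries_disjoint[OF q(1) z'(2)] y a_def by blast
          then show False
            using b_eq \<beta>_less[of x] \<beta>_less[of y] xN yN x(2) 2 by blast
        qed
        ultimately have "z \<in> set (?s (b (\<beta> z)))"
          using z'(2) unfolding set_switch_entries by (force simp: image_iff transpose_def)
        then show "z \<in> D ?s" using z' by (auto simp: D_def)
      qed
      ultimately have "D q \<subset> D ?s" by blast
      then have "card (D q) < card (D ?s)" by (intro psubset_card_mono) (auto simp: D_def)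
      then show ?thesis using zero w_less J by blast
    next
      case 3
      then show ?thesis using anti[OF q(1) \<beta>[OF xN] _ xy] \<beta>[OF yN] by simp
    qed
  qed
  have "g q = (\<Sum>y\<in>set (q a). g (switch_entries x y q))"
    by (rule garnir_first_kind[OF g q(1) a x(1)])
  also have "\<dots> = (\<Sum>y\<in>set (q a). if g (switch_entries x y q) = 0 then 0 else - g q)"
    using term_sign by (intro sum.cong) auto
  also have "\<dots> = - (of_nat (card {y \<in> set (q a). g (switch_entries x y q) \<noteq> 0}) * g q)"
    by (simp add: sum.If_cases Int_def)
  \<comment> \<open>With \<open>k\<close> nonzero terms the relation reads
    \<open>g q = - k * g q\<close>, and \<open>k + 1\<close> is nonzero in the complex
    numbers.\<close>
  finally have "of_nat (Suc (card {y \<in> set (q a). g (switch_entries x y q) \<noteq> 0})) * g q = 0"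
    by (simp add: distrib_right flip: eq_neg_iff_add_eq_0)
  then show False
    using q(2) by (simp del: of_nat_Suc)
qed

section \<open>Functionals on the quotient module\<close>

text \<open>Reduces computations in a quotient to representatives. In the last clause the image of a
  coset is assumed to be a coset again, which replaces a proof that \<open>H\<close> is stable under
  the permutations; for eigenvectors this assumption comes for free.\<close>

lemma quotient_module_cosets:
  assumes M: "Module.module complex_field M" and H: "submodule H complex_field M"
  shows carrier_quotient: "carrier (quotient_module M H) = (\<lambda>x. H +>\<^bsub>M\<^esub> x) ` carrier M"
    and zero_quotient: "\<zero>\<^bsub>quotient_module M H\<^esub> = H"
    and add_quotient: "\<And>x y. x \<in> carrier M \<Longrightarrow> y \<in> carrier M \<Longrightarrow>
      (H +>\<^bsub>M\<^esub> x) \<oplus>\<^bsub>quotient_module M H\<^esub> (H +>\<^bsub>M\<^esub> y) = H +>\<^bsub>M\<^esub> (x \<oplus>\<^bsub>M\<^esub> y)"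
    and smult_quotient: "\<And>c x. x \<in> carrier M \<Longrightarrow>
      c \<odot>\<^bsub>quotient_module M H\<^esub> (H +>\<^bsub>M\<^esub> x) = H +>\<^bsub>M\<^esub> (c \<odot>\<^bsub>M\<^esub> x)"
    and coset_eq_self: "\<And>x. x \<in> H \<Longrightarrow> H +>\<^bsub>M\<^esub> x = H"
    and perm_act_quotient: "\<And>\<sigma> x. x \<in> carrier M \<Longrightarrow>
      perm_act (quotient_module M H) \<sigma> (H +>\<^bsub>M\<^esub> x) \<in> carrier (quotient_module M H) \<Longrightarrow>
      perm_act M \<sigma> x \<in> carrier M \<and>
      perm_act (quotient_module M H) \<sigma> (H +>\<^bsub>M\<^esub> x) = H +>\<^bsub>M\<^esub> (perm_act M \<sigma> x)"
proof -
  let ?Q = "quotient_module M H"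
  interpret Module.module complex_field M by (fact M)
  interpret H: abelian_subgroup H M
    using H by (intro abelian_subgroupI3 additive_subgroupI)
      (auto simp: submodule_def abelian_group_axioms)
  show car: "carrier ?Q = (\<lambda>x. H +>\<^bsub>M\<^esub> x) ` carrier M"
    by (auto simp: quotient_module_def A_RCOSETS_def')
  show "\<zero>\<^bsub>?Q\<^esub> = H"
    by (simp add: quotient_module_def)
  show "(H +>\<^bsub>M\<^esub> x) \<oplus>\<^bsub>?Q\<^esub> (H +>\<^bsub>M\<^esub> y) = H +>\<^bsub>M\<^esub> (x \<oplus>\<^bsub>M\<^esub> y)"
    if "x \<in> carrier M" "y \<in> carrier M" for x y
    using H.a_rcos_sum[OF that] by (simp add: quotient_module_def)
  show "H +>\<^bsub>M\<^esub> x = H" if "x \<in> H" for x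
    using that by (rule H.a_rcos_const)
  show "c \<odot>\<^bsub>?Q\<^esub> (H +>\<^bsub>M\<^esub> x) = H +>\<^bsub>M\<^esub> (c \<odot>\<^bsub>M\<^esub> x)" if x: "x \<in> carrier M" for c x
  proof -
    have "H +>\<^bsub>M\<^esub> (c \<odot>\<^bsub>M\<^esub> y) = H +>\<^bsub>M\<^esub> (c \<odot>\<^bsub>M\<^esub> x)" if y: "y \<in> H +>\<^bsub>M\<^esub> x" for y
    proof -
      obtain h where h: "h \<in> H" "y = h \<oplus>\<^bsub>M\<^esub> x"
        using y by (auto simp: a_r_coset_def')
      have "c \<odot>\<^bsub>M\<^esub> y = (c \<odot>\<^bsub>M\<^esub> h) \<oplus>\<^bsub>M\<^esub> (c \<odot>\<^bsub>M\<^esub> x)"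
        using h x H.a_subset by (auto intro!: smult_r_distr)
      moreover have "c \<odot>\<^bsub>M\<^esub> h \<in> H"
        using submoduleE(4)[OF H] h by simp
      ultimately have "c \<odot>\<^bsub>M\<^esub> y \<in> H +>\<^bsub>M\<^esub> (c \<odot>\<^bsub>M\<^esub> x)"
        by (auto simp: a_r_coset_def')
      then show ?thesis
        using x by (metis H.a_repr_independence' smult_closed complex_field_sel(1) UNIV_I)
    qed
    moreover have "x \<in> H +>\<^bsub>M\<^esub> x" using x by (rule H.a_rcos_self)
    ultimately have "(\<Union>y\<in>H +>\<^bsub>M\<^esub> x. H +>\<^bsub>M\<^esub> (c \<odot>\<^bsub>M\<^esub> y)) = H +>\<^bsub>M\<^esub> (c \<odot>\<^bsub>M\<^esub> x)"
      by blast
    then show ?thesis by (simp add: quotient_module_def)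
  qed
  show "perm_act M \<sigma> x \<in> carrier M \<and> perm_act ?Q \<sigma> (H +>\<^bsub>M\<^esub> x) = H +>\<^bsub>M\<^esub> (perm_act M \<sigma> x)"
    if x: "x \<in> carrier M" and X: "perm_act ?Q \<sigma> (H +>\<^bsub>M\<^esub> x) \<in> carrier ?Q" for \<sigma> x
  proof -
    \<comment> \<open>The image of the representative lies in the image of its coset, and a coset is
      determined by any of its elements.\<close>
    have "x \<in> H +>\<^bsub>M\<^esub> x" using x by (rule H.a_rcos_self)
    then have mem: "perm_act M \<sigma> x \<in> perm_act ?Q \<sigma> (H +>\<^bsub>M\<^esub> x)"
      by (simp add: quotient_module_def)
    obtain y where y: "y \<in> carrier M" "perm_act ?Q \<sigma> (H +>\<^bsub>M\<^esub> x) = H +>\<^bsub>M\<^esub> y"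
      using X unfolding car by blast
    then show ?thesis
      using mem H.a_repr_independence' H.a_subset a_r_coset_subset_G by (metis subsetD)
  qed
qed

section \<open>Representatives in the twofold quotient \<open>S_tilde\<close>\<close>

definition S_tilde_class ::
    "plane_tree \<Rightarrow> nat \<Rightarrow> (nat list \<Rightarrow> nat) \<Rightarrow> ((nat list \<Rightarrow> nat list) \<Rightarrow> complex)
      \<Rightarrow> ((nat list \<Rightarrow> nat list) \<Rightarrow> complex) set set" where
  "S_tilde_class T N \<mu> f =
    G_tilde T N \<mu> +>\<^bsub>M_module T N \<mu>\<^esub> (column_relations T N \<mu> +>\<^bsub>tableau_module T N \<mu>\<^esub> f)"

lemma tableau_module_sel [simp]:
  "f \<in> carrier (tableau_module T N \<mu>) \<longleftrightarrow> (\<forall>t. t \<notin> tree_tableaux T N \<mu> \<longrightarrow> f t = 0)"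
  "f \<oplus>\<^bsub>tableau_module T N \<mu>\<^esub> g = (\<lambda>t. f t + g t)"
  "c \<odot>\<^bsub>tableau_module T N \<mu>\<^esub> f = (\<lambda>t. c * f t)"
  "\<zero>\<^bsub>tableau_module T N \<mu>\<^esub> = (\<lambda>t. 0)"
  "perm_act (tableau_module T N \<mu>) \<sigma> f = (\<lambda>t. f (permute_entries (Hilbert_Choice.inv \<sigma>) t))"
  by (simp_all add: tableau_module_def free_perm_module_def)

lemmas M_cosets = quotient_module_cosets[OF module_tableau_module submodule_column_relations, folded M_module_def]
lemmas S_cosets = quotient_module_cosets[OF module_M_module submodule_G_tilde, folded S_tilde_def]

lemma M_coset_closed:
  "f \<in> carrier (tableau_module T N \<mu>) \<Longrightarrow>
    column_relations T N \<mu> +>\<^bsub>tableau_module T N \<mu>\<^esub> f \<in> carrier (M_module T N \<mu>)"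
  unfolding M_cosets(1) by blast

lemma S_tilde_class:
  shows carrier_S_tilde: "carrier (S_tilde T N \<mu>) = S_tilde_class T N \<mu> ` carrier (tableau_module T N \<mu>)"
    and S_tilde_class_add: "\<And>f g. f \<in> carrier (tableau_module T N \<mu>) \<Longrightarrow> g \<in> carrier (tableau_module T N \<mu>) \<Longrightarrow>
      S_tilde_class T N \<mu> (\<lambda>t. f t + g t) = S_tilde_class T N \<mu> f \<oplus>\<^bsub>S_tilde T N \<mu>\<^esub> S_tilde_class T N \<mu> g"
    and S_tilde_class_smult: "\<And>c f. f \<in> carrier (tableau_module T N \<mu>) \<Longrightarrow>
      S_tilde_class T N \<mu> (\<lambda>t. c * f t) = c \<odot>\<^bsub>S_tilde T N \<mu>\<^esub> S_tilde_class T N \<mu> f"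
    and S_tilde_class_perm: "\<And>\<sigma> f. f \<in> carrier (tableau_module T N \<mu>) \<Longrightarrow>
      perm_act (S_tilde T N \<mu>) \<sigma> (S_tilde_class T N \<mu> f) \<in> carrier (S_tilde T N \<mu>) \<Longrightarrow>
      (\<lambda>t. f (permute_entries (Hilbert_Choice.inv \<sigma>) t)) \<in> carrier (tableau_module T N \<mu>) \<and>
      perm_act (S_tilde T N \<mu>) \<sigma> (S_tilde_class T N \<mu> f) =
        S_tilde_class T N \<mu> (\<lambda>t. f (permute_entries (Hilbert_Choice.inv \<sigma>) t))"
proof -
  show "carrier (S_tilde T N \<mu>) = S_tilde_class T N \<mu> ` carrier (tableau_module T N \<mu>)"
    unfolding S_cosets(1) M_cosets(1) S_tilde_class_def by (simp add: image_image)
next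
  fix f g assume fg: "f \<in> carrier (tableau_module T N \<mu>)" "g \<in> carrier (tableau_module T N \<mu>)"
  show "S_tilde_class T N \<mu> (\<lambda>t. f t + g t) = S_tilde_class T N \<mu> f \<oplus>\<^bsub>S_tilde T N \<mu>\<^esub> S_tilde_class T N \<mu> g"
    unfolding S_tilde_class_def
    using S_cosets(3)[OF fg[THEN M_coset_closed]] M_cosets(3)[OF fg] by simp
next
  fix c f assume f: "f \<in> carrier (tableau_module T N \<mu>)"
  show "S_tilde_class T N \<mu> (\<lambda>t. c * f t) = c \<odot>\<^bsub>S_tilde T N \<mu>\<^esub> S_tilde_class T N \<mu> f"
    unfolding S_tilde_class_def
    using S_cosets(4)[OF M_coset_closed[OF f], of c] M_cosets(4)[OF f, of c] by simp
next
  fix \<sigma> f assume f: "f \<in> carrier (tableau_module T N \<mu>)"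
    "perm_act (S_tilde T N \<mu>) \<sigma> (S_tilde_class T N \<mu> f) \<in> carrier (S_tilde T N \<mu>)"
  have *: "perm_act (M_module T N \<mu>) \<sigma> (column_relations T N \<mu> +>\<^bsub>tableau_module T N \<mu>\<^esub> f) \<in> carrier (M_module T N \<mu>)"
    "perm_act (S_tilde T N \<mu>) \<sigma> (S_tilde_class T N \<mu> f) = G_tilde T N \<mu> +>\<^bsub>M_module T N \<mu>\<^esub>
      perm_act (M_module T N \<mu>) \<sigma> (column_relations T N \<mu> +>\<^bsub>tableau_module T N \<mu>\<^esub> f)"
    using S_cosets(6)[OF M_coset_closed[OF f(1)] f(2)[unfolded S_tilde_class_def]]
    by (simp_all add: S_tilde_class_def)
  show "(\<lambda>t. f (permute_entries (Hilbert_Choice.inv \<sigma>) t)) \<in> carrier (tableau_module T N \<mu>) \<and>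
      perm_act (S_tilde T N \<mu>) \<sigma> (S_tilde_class T N \<mu> f) =
        S_tilde_class T N \<mu> (\<lambda>t. f (permute_entries (Hilbert_Choice.inv \<sigma>) t))"
    using M_cosets(6)[OF f(1) *(1)] *(2) by (simp add: S_tilde_class_def)
qed

lemma zero_class: "column_relations T N \<mu> +>\<^bsub>tableau_module T N \<mu>\<^esub> (\<lambda>t. 0) = \<zero>\<^bsub>M_module T N \<mu>\<^esub>"
proof -
  have "(\<lambda>t. 0) \<in> column_relations T N \<mu>"
    using submodule_column_relations[of T N \<mu>] by (auto simp: submodule_def dest!: subgroup.one_closed)
  then show ?thesis unfolding M_cosets(2) by (rule M_cosets(5))
qed

lemma zero_in_G_tilde: "\<zero>\<^bsub>M_module T N \<mu>\<^esub> \<in> G_tilde T N \<mu>"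
  using submodule_G_tilde[of T N \<mu>] by (auto simp: submodule_def dest!: subgroup.one_closed)

lemma S_tilde_class_eq_zero:
  assumes "column_relations T N \<mu> +>\<^bsub>tableau_module T N \<mu>\<^esub> f \<in> G_tilde T N \<mu>"
  shows "S_tilde_class T N \<mu> f = \<zero>\<^bsub>S_tilde T N \<mu>\<^esub>"
  using assms unfolding S_tilde_class_def S_cosets(2) by (rule S_cosets(5))

lemma S_tilde_class_column_relation:
  assumes "t \<in> tree_tableaux T N \<mu>" "x \<in> set (t a)" "y \<in> set (t a)" "x \<noteq> y"
  shows "S_tilde_class T N \<mu> (\<lambda>s. basis_vec t s + basis_vec (switch_entries x y t) s) = \<zero>\<^bsub>S_tilde T N \<mu>\<^esub>"
proof -
  let ?f = "\<lambda>s. basis_vec t s + basis_vec (switch_entries x y t) s"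
  have "a \<in> nodes T" using assms by (auto simp: tree_tableaux_def)
  then have "?f \<in> column_relations T N \<mu>"
    using assms unfolding column_relations_def submodule_span_def
    by (intro hull_inc CollectI exI[of _ t] exI[of _ a] exI[of _ x] exI[of _ y]) auto
  then have "column_relations T N \<mu> +>\<^bsub>tableau_module T N \<mu>\<^esub> ?f = \<zero>\<^bsub>M_module T N \<mu>\<^esub>"
    unfolding M_cosets(2) by (rule M_cosets(5))
  then show ?thesis using zero_in_G_tilde by (intro S_tilde_class_eq_zero) simp
qed

lemma finsum_M_cosets:
  assumes "finite A" "\<And>i. i \<in> A \<Longrightarrow> F i \<in> carrier (tableau_module T N \<mu>)"
  shows "(\<Oplus>\<^bsub>M_module T N \<mu>\<^esub> i \<in> A. column_relations T N \<mu> +>\<^bsub>tableau_module T N \<mu>\<^esub> F i) =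
    column_relations T N \<mu> +>\<^bsub>tableau_module T N \<mu>\<^esub> (\<lambda>t. \<Sum>i\<in>A. F i t)"
  using assms
proof (induction A rule: finite_induct)
  case empty
  interpret Module.module complex_field "M_module T N \<mu>" by (rule module_M_module)
  show ?case by (simp add: zero_class)
next
  case (insert i A)
  interpret Module.module complex_field "M_module T N \<mu>" by (rule module_M_module)
  have "(\<lambda>t. \<Sum>i\<in>A. F i t) \<in> carrier (tableau_module T N \<mu>)"
    using insert.prems by simp
  with insert show ?case
    by (subst M.finsum_insert) (auto intro!: M_coset_closed simp: M_cosets(3) Pi_iff simp del: tableau_module_sel(1))
qed

lemma descendants_root: "descendants T [] = nodes T - {[]}"
  by (auto simp: descendants_def strict_prefix_def)

lemma root_internal:
  assumes "nodes T \<noteq> {[]}"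
  shows "[] \<in> internal_nodes T"
proof -
  obtain ts where T: "T = Node ts" by (cases T)
  obtain i where i: "i < length ts" using assms by (auto simp: T nodes_Node)
  have "[i] \<in> nodes T" unfolding T nodes_Node using i by (intro insertI2 UN_I[of i]) auto
  then show ?thesis by (auto simp: internal_nodes_def is_parent_def)
qed

lemma S_tilde_class_garnir:
  assumes t: "t \<in> tree_tableaux T N \<mu>"
  shows "S_tilde_class T N \<mu> (\<lambda>s. of_nat (card (nodes T - {[]}) * \<mu> []) * basis_vec t s
      - (\<Sum>p \<in> set (t []) \<times> (\<Union>b \<in> nodes T - {[]}. set (t b)).
          basis_vec (switch_entries (fst p) (snd p) t) s)) = \<zero>\<^bsub>S_tilde T N \<mu>\<^esub>"
    (is "S_tilde_class T N \<mu> (\<lambda>s. ?c * _ s - (\<Sum>p \<in> ?P. ?F p s)) = _")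
proof (cases "nodes T = {[]}")
  \<comment> \<open>For the one-node tree the root is a leaf and offers no generator, but the
    coefficient is then 0 and the sum empty, so the relation is trivial.\<close>
  case True
  then show ?thesis by (simp add: S_tilde_class_eq_zero zero_class zero_in_G_tilde)
next
  case False
  interpret Module.module complex_field "M_module T N \<mu>" by (rule module_M_module)
  let ?q = "\<lambda>f. column_relations T N \<mu> +>\<^bsub>tableau_module T N \<mu>\<^esub> f"
  let ?S = "\<lambda>s. \<Sum>p \<in> ?P. ?F p s"
  have F: "?F p \<in> carrier (tableau_module T N \<mu>)" if "p \<in> ?P" for p
    using that by (auto intro!: basis_vec_closed switch_in_tree_tableaux[OF t] simp del: tableau_module_sel(1))
  have S: "?S \<in> carrier (tableau_module T N \<mu>)"
    using F by simp
  have nS: "(\<lambda>s. (-1) * ?S s) \<in> carrier (tableau_module T N \<mu>)"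
    using S by auto
  have b: "basis_vec t \<in> carrier (tableau_module T N \<mu>)" by (rule basis_vec_closed[OF t])
  then have cb: "(\<lambda>s. ?c * basis_vec t s) \<in> carrier (tableau_module T N \<mu>)" by auto
  have "?q (\<lambda>s. (-1) * ?S s) \<oplus>\<^bsub>M_module T N \<mu>\<^esub> ?q ?S = \<zero>\<^bsub>M_module T N \<mu>\<^esub>"
    using M_cosets(3)[OF nS S] zero_class by simp
  then have neg: "\<ominus>\<^bsub>M_module T N \<mu>\<^esub> ?q ?S = ?q (\<lambda>s. (-1) * ?S s)"
    by (rule M.minus_equality) (intro M_coset_closed S nS)+
  have sum: "(\<Oplus>\<^bsub>M_module T N \<mu>\<^esub> p \<in> ?P. tableau_class T N \<mu> (switch_entries (fst p) (snd p) t)) = ?q ?S"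
    unfolding tableau_class_def using F by (intro finsum_M_cosets) (auto simp: finite_nodes simp del: tableau_module_sel(1))
  have "garnir_second T N \<mu> [] t = ?q (\<lambda>s. ?c * basis_vec t s) \<oplus>\<^bsub>M_module T N \<mu>\<^esub> ?q (\<lambda>s. (-1) * ?S s)"
    unfolding garnir_second_def descendants_root sum a_minus_def neg
    using M_cosets(4)[OF b] by (simp add: tableau_class_def)
  also have "\<dots> = ?q (\<lambda>s. ?c * basis_vec t s - ?S s)"
    unfolding M_cosets(3)[OF cb nS] by simp
  finally have eq: "garnir_second T N \<mu> [] t = ?q (\<lambda>s. ?c * basis_vec t s - ?S s)" .
  have "garnir_second T N \<mu> [] t \<in> G_tilde T N \<mu>"
    unfolding G_tilde_def submodule_span_def using t root_internal[OF False] by (intro hull_inc) blast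
  then show ?thesis
    unfolding eq by (rule S_tilde_class_eq_zero)
qed

section \<open>Separating and averaging functionals\<close>

text \<open>A basis of \<open>H\<close> stays independent when \<open>f\<close> is added, so some
  linear form is 1 on \<open>f\<close> and 0 on \<open>H\<close>. As \<open>B\<close> is finite, the
  form is given by its values on the basis vectors, and these values are \<open>g\<close>.\<close>

lemma separating_functional:
  fixes H :: "('x \<Rightarrow> complex) set"
  assumes B: "finite B" and supp: "\<And>h x. h \<in> insert f H \<Longrightarrow> x \<notin> B \<Longrightarrow> h x = 0"
    and zero: "(\<lambda>x. 0) \<in> H" and add: "\<And>h k. h \<in> H \<Longrightarrow> k \<in> H \<Longrightarrow> (\<lambda>x. h x + k x) \<in> H"
    and scale: "\<And>c h. h \<in> H \<Longrightarrow> (\<lambda>x. c * h x) \<in> H"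
    and f: "f \<notin> H"
  obtains g where "\<And>h. h \<in> H \<Longrightarrow> (\<Sum>x\<in>B. g x * h x) = 0" "(\<Sum>x\<in>B. g x * f x) \<noteq> 0"
proof -
  \<comment> \<open>Pointwise scaling turns the full function space into a vector space in the sense
    of the HOL linear algebra locales; \<open>H\<close> is a subspace of it.\<close>
  let ?s = "\<lambda>c (h :: 'x \<Rightarrow> complex) x. c * h x"
  interpret V: vector_space ?s
    by unfold_locales (auto simp: fun_eq_iff algebra_simps)
  interpret C: vector_space "(*) :: complex \<Rightarrow> complex \<Rightarrow> complex"
    by unfold_locales (auto simp: algebra_simps)
  interpret VC: vector_space_pair ?s "(*) :: complex \<Rightarrow> complex \<Rightarrow> complex"
    by (rule vector_space_pair.intro) (rule V.vector_space_axioms, rule C.vector_space_axioms)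
  have sub: "V.subspace H"
    using zero add scale by (auto simp: V.subspace_def zero_fun_def plus_fun_def)
  obtain E where E: "E \<subseteq> H" "V.independent E" "H \<subseteq> V.span E"
    by (rule V.maximal_independent_subset)
  have "f \<notin> V.span E" using f E(1) V.span_minimal[OF E(1) sub] by blast
  then have "V.independent (insert f E)" using E(2) by (rule V.independent_insertI)
  then obtain \<psi> where lin: "Vector_Spaces.linear ?s (*) \<psi>" and
    \<psi>: "\<And>x. x \<in> insert f E \<Longrightarrow> \<psi> x = (if x = f then 1 else 0)"
    using VC.linear_independent_extend[of "insert f E" "\<lambda>x. if x = f then 1 else 0"] by blast
  interpret \<psi>: Vector_Spaces.linear ?s "(*) :: complex \<Rightarrow> complex \<Rightarrow> complex" \<psi> by (fact lin)
  have eval: "(\<Sum>x\<in>B. \<psi> (basis_vec x) * h x) = \<psi> h" if h: "h \<in> insert f H" for h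
  proof -
    have "h = (\<Sum>x\<in>B. ?s (h x) (basis_vec x))"
    proof
      fix y
      have "(\<Sum>x\<in>B. h x * basis_vec x y) = (if y \<in> B then h y else 0)"
        using B by (simp add: basis_vec_def if_distrib cong: if_cong)
      moreover have "sum F B y = (\<Sum>x\<in>B. F x y)" for F :: "'x \<Rightarrow> 'x \<Rightarrow> complex"
        using B by induction (auto simp: zero_fun_def plus_fun_def)
      ultimately show "h y = (\<Sum>x\<in>B. ?s (h x) (basis_vec x)) y"
        using supp[OF h, of y] by simp
    qed
    then have "\<psi> h = \<psi> (\<Sum>x\<in>B. ?s (h x) (basis_vec x))" by simp
    also have "\<dots> = (\<Sum>x\<in>B. h x * \<psi> (basis_vec x))"
      by (simp only: \<psi>.sum \<psi>.scale)
    finally show ?thesis by (simp add: mult.commute)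
  qed
  have "\<psi> x = 0" if "x \<in> E" for x
    using \<psi>[of x] that f E(1) by (metis insertI2 subsetD)
  then have "\<psi> h = 0" if "h \<in> V.span E" for h
    using VC.linear_eq_0_on_span[OF lin _ that] by blast
  then show ?thesis
    using that[of "\<lambda>x. \<psi> (basis_vec x)"] eval E(3) \<psi>[of f]
    by (metis insertI1 insertI2 subsetD zero_neq_one)
qed

text \<open>Permuting entries conjugates every switch into a switch of the image entries, so
  relations go to relations. Together with closure under linear combinations this permits averaging
  over a group.\<close>

lemma garnir_functional_permute:
  assumes g: "garnir_functional T N \<mu> g" and \<sigma>: "\<sigma> permutes {1..N}"
  shows "garnir_functional T N \<mu> (\<lambda>t. g (permute_entries \<sigma> t))"
  unfolding garnir_functional_def
proof (intro conjI ballI allI impI)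
  have bij: "bij \<sigma>" and inj: "inj \<sigma>"
    using permutes_bij[OF \<sigma>] permutes_inj[OF \<sigma>] by auto
  fix t assume t: "t \<in> tree_tableaux T N \<mu>"
  note \<sigma>t = permute_entries_tree_tableaux[OF t \<sigma>]
  have set: "set (permute_entries \<sigma> t a) = \<sigma> ` set (t a)" for a
    by (simp add: permute_entries_def)
  show "g (permute_entries \<sigma> (switch_entries x y t)) = - g (permute_entries \<sigma> t)"
    if "x \<in> set (t a)" "y \<in> set (t a)" "x \<noteq> y" for a x y
    using that inj unfolding permute_switch_entries[OF bij]
    by (intro garnir_functional_switch[OF g \<sigma>t, of _ a]) (auto simp: set inj_eq)
  let ?P = "\<lambda>t. set (t []) \<times> (\<Union>b \<in> nodes T - {[]}. set (t b))"
  have P: "?P (permute_entries \<sigma> t) = map_prod \<sigma> \<sigma> ` ?P t"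
    unfolding set image_UN [symmetric] by (simp add: image_paired_Times map_prod_def)
  have "of_nat (card (nodes T - {[]}) * \<mu> []) * g (permute_entries \<sigma> t) =
      (\<Sum>p \<in> ?P (permute_entries \<sigma> t). g (switch_entries (fst p) (snd p) (permute_entries \<sigma> t)))"
    using g \<sigma>t unfolding garnir_functional_def by blast
  also have "\<dots> = (\<Sum>p \<in> ?P t. g (permute_entries \<sigma> (switch_entries (fst p) (snd p) t)))"
    unfolding P using inj
    by (subst sum.reindex) (auto simp: permute_switch_entries[OF bij] intro!: inj_on_subset[OF prod.inj_map])
  finally show "of_nat (card (nodes T - {[]}) * \<mu> []) * g (permute_entries \<sigma> t) =
      (\<Sum>p \<in> ?P t. g (permute_entries \<sigma> (switch_entries (fst p) (snd p) t)))" .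
qed

lemma garnir_functional_sum:
  assumes "\<And>i. i \<in> A \<Longrightarrow> garnir_functional T N \<mu> (F i)"
  shows "garnir_functional T N \<mu> (\<lambda>t. \<Sum>i\<in>A. c i * F i t)"
  unfolding garnir_functional_def
proof (intro conjI ballI allI impI)
  fix t assume t: "t \<in> tree_tableaux T N \<mu>"
  show "(\<Sum>i\<in>A. c i * F i (switch_entries x y t)) = - (\<Sum>i\<in>A. c i * F i t)"
    if "x \<in> set (t a)" "y \<in> set (t a)" "x \<noteq> y" for a x y
    using garnir_functional_switch[OF assms t that] by (simp add: sum_negf)
  let ?P = "set (t []) \<times> (\<Union>b \<in> nodes T - {[]}. set (t b))"
  have "(\<Sum>p\<in>?P. \<Sum>i\<in>A. c i * F i (switch_entries (fst p) (snd p) t)) =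
      (\<Sum>i\<in>A. c i * (\<Sum>p\<in>?P. F i (switch_entries (fst p) (snd p) t)))"
    by (subst sum.swap) (simp add: sum_distrib_left)
  also have "\<dots> = (\<Sum>i\<in>A. c i * (of_nat (card (nodes T - {[]}) * \<mu> []) * F i t))"
    using assms t unfolding garnir_functional_def by (intro sum.cong) auto
  finally show "of_nat (card (nodes T - {[]}) * \<mu> []) * (\<Sum>i\<in>A. c i * F i t) =
      (\<Sum>p\<in>?P. \<Sum>i\<in>A. c i * F i (switch_entries (fst p) (snd p) t))"
    by (simp add: sum_distrib_left mult_ac)
qed

text \<open>A nonzero class is separated from the kernel of the quotient map. Evaluating the
  resulting functional on the relations, written in basis vectors, yields the defining identities of
  \<open>garnir_functional\<close>. The vanishing on the whole kernel is kept for comparing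
  representatives of one class.\<close>

lemma garnir_functional_exists:
  assumes f: "f \<in> carrier (tableau_module T N \<mu>)" "S_tilde_class T N \<mu> f \<noteq> \<zero>\<^bsub>S_tilde T N \<mu>\<^esub>"
  obtains g where "garnir_functional T N \<mu> g" "(\<Sum>t\<in>tree_tableaux T N \<mu>. g t * f t) \<noteq> 0"
    "\<And>h. h \<in> carrier (tableau_module T N \<mu>) \<Longrightarrow> S_tilde_class T N \<mu> h = \<zero>\<^bsub>S_tilde T N \<mu>\<^esub> \<Longrightarrow>
      (\<Sum>t\<in>tree_tableaux T N \<mu>. g t * h t) = 0"
proof -
  let ?B = "tree_tableaux T N \<mu>" and ?Q = "S_tilde T N \<mu>" and ?C = "S_tilde_class T N \<mu>"
  interpret Module.module complex_field ?Q by (rule module_S_tilde)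
  define H where "H = {h \<in> carrier (tableau_module T N \<mu>). ?C h = \<zero>\<^bsub>?Q\<^esub>}"
  have zero: "?C (\<lambda>t. 0) = \<zero>\<^bsub>?Q\<^esub>"
    using S_tilde_class_smult[OF f(1), of 0] carrier_S_tilde[of T N \<mu>] f(1) smult_l_null by auto
  obtain g where g: "\<And>h. h \<in> H \<Longrightarrow> (\<Sum>t\<in>?B. g t * h t) = 0" "(\<Sum>t\<in>?B. g t * f t) \<noteq> 0"
  proof (rule separating_functional[of ?B f H])
    show "(\<lambda>t. h t + k t) \<in> H" if "h \<in> H" "k \<in> H" for h k
      using that S_tilde_class_add[of h T N \<mu> k] by (auto simp: H_def)
    show "(\<lambda>t. c * h t) \<in> H" if "h \<in> H" for c h
      using that S_tilde_class_smult[of h T N \<mu> c] smult_r_null[of c] by (auto simp: H_def)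
  qed (use f zero finite_tree_tableaux in \<open>auto simp: H_def\<close>)
  have basis: "(\<Sum>t\<in>?B. g t * basis_vec s t) = g s" if "s \<in> ?B" for s
    using that finite_tree_tableaux by (simp add: basis_vec_def if_distrib cong: if_cong)
  have "garnir_functional T N \<mu> g"
    unfolding garnir_functional_def
  proof (intro conjI ballI allI impI)
    fix t assume t: "t \<in> ?B"
    show "g (switch_entries x y t) = - g t"
      if xy: "x \<in> set (t a)" "y \<in> set (t a)" "x \<noteq> y" for a x y
    proof -
      have s: "switch_entries x y t \<in> ?B" using switch_in_tree_tableaux[OF t xy(1,2)] .
      have "(\<lambda>s. basis_vec t s + basis_vec (switch_entries x y t) s) \<in> H"
        using S_tilde_class_column_relation[OF t xy] t s by (auto simp: H_def basis_vec_def)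
      then have "g t + g (switch_entries x y t) = 0"
        using g(1) basis[OF t] basis[OF s] by (fastforce simp: distrib_left sum.distrib)
      then show ?thesis by (simp add: add_eq_0_iff)
    qed
    let ?P = "set (t []) \<times> (\<Union>b \<in> nodes T - {[]}. set (t b))"
    let ?c = "of_nat (card (nodes T - {[]}) * \<mu> []) :: complex"
    let ?h = "\<lambda>s. ?c * basis_vec t s - (\<Sum>p \<in> ?P. basis_vec (switch_entries (fst p) (snd p) t) s)"
    have P: "switch_entries (fst p) (snd p) t \<in> ?B" if "p \<in> ?P" for p
      using that switch_in_tree_tableaux[OF t] by auto
    have "?h \<in> carrier (tableau_module T N \<mu>)"
      using basis_vec_closed[OF t] basis_vec_closed[OF P] by simp
    then have "?h \<in> H" using S_tilde_class_garnir[OF t] by (simp add: H_def)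
    then have "0 = (\<Sum>s\<in>?B. g s * ?h s)" using g(1) by simp
    also have "\<dots> = ?c * (\<Sum>s\<in>?B. g s * basis_vec t s) -
        (\<Sum>s\<in>?B. \<Sum>p \<in> ?P. g s * basis_vec (switch_entries (fst p) (snd p) t) s)"
      by (simp add: right_diff_distrib sum_subtractf sum_distrib_left mult.left_commute)
    also have "(\<Sum>s\<in>?B. \<Sum>p \<in> ?P. g s * basis_vec (switch_entries (fst p) (snd p) t) s) =
        (\<Sum>p \<in> ?P. \<Sum>s\<in>?B. g s * basis_vec (switch_entries (fst p) (snd p) t) s)"
      by (rule sum.swap)
    also have "\<dots> = (\<Sum>p \<in> ?P. g (switch_entries (fst p) (snd p) t))"
      using P by (intro sum.cong refl basis)
    finally show "?c * g t = (\<Sum>p \<in> ?P. g (switch_entries (fst p) (snd p) t))"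
      by (simp add: basis[OF t])
  qed
  then show ?thesis
    using that g unfolding H_def by blast
qed

text \<open>Averaging a separating functional over \<open>K\<close> against the character
  \<open>\<chi>\<close> gives the required equivariance. The average is nonzero because each group
  element contributes the same value on \<open>f\<close>, for a total of \<open>card K\<close> times
  the original one.\<close>

lemma isotypic_garnir_functional:
  fixes \<chi> :: "(nat \<Rightarrow> nat) \<Rightarrow> complex"
  assumes f: "f \<in> carrier (tableau_module T N \<mu>)" "S_tilde_class T N \<mu> f \<noteq> \<zero>\<^bsub>S_tilde T N \<mu>\<^esub>"
    and K: "\<And>\<sigma>. \<sigma> \<in> K \<Longrightarrow> \<sigma> permutes {1..N}" "id \<in> K"
      "\<And>\<sigma> \<tau>. \<sigma> \<in> K \<Longrightarrow> \<tau> \<in> K \<Longrightarrow> \<sigma> \<circ> \<tau> \<in> K" "\<And>\<sigma>. \<sigma> \<in> K \<Longrightarrow> Hilbert_Choice.inv \<sigma> \<in> K"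
    and \<chi>: "\<And>\<sigma> \<tau>. \<sigma> \<in> K \<Longrightarrow> \<tau> \<in> K \<Longrightarrow> \<chi> (\<sigma> \<circ> \<tau>) = \<chi> \<sigma> * \<chi> \<tau>" "\<And>\<sigma>. \<sigma> \<in> K \<Longrightarrow> \<chi> \<sigma> * \<chi> \<sigma> = 1"
    and eigen: "\<And>\<sigma>. \<sigma> \<in> K \<Longrightarrow> perm_act (S_tilde T N \<mu>) \<sigma> (S_tilde_class T N \<mu> f) =
      \<chi> \<sigma> \<odot>\<^bsub>S_tilde T N \<mu>\<^esub> S_tilde_class T N \<mu> f"
  obtains g s where "garnir_functional T N \<mu> g" "s \<in> tree_tableaux T N \<mu>" "g s \<noteq> 0"
    "\<And>\<sigma> t. \<sigma> \<in> K \<Longrightarrow> g (permute_entries \<sigma> t) = \<chi> \<sigma> * g t"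
proof -
  let ?B = "tree_tableaux T N \<mu>" and ?Q = "S_tilde T N \<mu>" and ?C = "S_tilde_class T N \<mu>"
  interpret Module.module complex_field ?Q by (rule module_S_tilde)
  have finK: "finite K"
    by (rule finite_subset[OF _ finite_permutations[of "{1..N}"]]) (use K(1) in auto)
  obtain g where g: "garnir_functional T N \<mu> g" "(\<Sum>t\<in>?B. g t * f t) \<noteq> 0"
    "\<And>h. h \<in> carrier (tableau_module T N \<mu>) \<Longrightarrow> ?C h = \<zero>\<^bsub>?Q\<^esub> \<Longrightarrow> (\<Sum>t\<in>?B. g t * h t) = 0"
    using garnir_functional_exists[OF f] by blast
  have Cf: "?C f \<in> carrier ?Q" using f(1) by (simp add: carrier_S_tilde del: tableau_module_sel)
  have invol: "permute_entries (Hilbert_Choice.inv \<sigma>) (permute_entries \<sigma> t) = t" if "\<sigma> \<in> K" for \<sigma> t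
    using permutes_inv_o(2)[OF K(1)[OF that]]
    by (simp flip: permute_entries_comp) (simp add: permute_entries_def)
  have twist: "(\<Sum>t\<in>?B. g (permute_entries \<sigma> t) * f t) = \<chi> \<sigma> * (\<Sum>t\<in>?B. g t * f t)"
    if \<sigma>: "\<sigma> \<in> K" for \<sigma>
  proof -
    let ?h = "\<lambda>t. f (permute_entries (Hilbert_Choice.inv \<sigma>) t)"
    have maps: "permute_entries \<sigma> t \<in> ?B" if "t \<in> ?B" for t
      using that K(1)[OF \<sigma>] by (rule permute_entries_tree_tableaux)
    have bij: "bij_betw (permute_entries \<sigma>) ?B ?B"
      by (intro bij_betw_imageI endo_inj_surj finite_tree_tableaux
          inj_on_inverseI[of _ "permute_entries (Hilbert_Choice.inv \<sigma>)"])
        (auto simp: invol \<sigma> maps)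
    have "(\<Sum>t\<in>?B. g (permute_entries \<sigma> t) * f t) = (\<Sum>t\<in>?B. g (permute_entries \<sigma> t) * ?h (permute_entries \<sigma> t))"
      by (simp add: invol[OF \<sigma>])
    also have "\<dots> = (\<Sum>t\<in>?B. g t * ?h t)"
      using sum.reindex_bij_betw[OF bij, of "\<lambda>t. g t * ?h t"] by simp
    also have "\<dots> = \<chi> \<sigma> * (\<Sum>t\<in>?B. g t * f t)"
    proof -
      \<comment> \<open>The eigenvector equation itself shows that the image of the class is a
        coset. Hence the permuted \<open>f\<close> and \<open>\<chi> \<sigma>\<close> times
        \<open>f\<close> represent the same class, and \<open>g\<close> kills their
        difference.\<close>
      have "perm_act ?Q \<sigma> (?C f) \<in> carrier ?Q" using eigen[OF \<sigma>] Cf by simp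
      from S_tilde_class_perm[OF f(1) this] eigen[OF \<sigma>]
      have h: "?h \<in> carrier (tableau_module T N \<mu>)" "?C ?h = \<chi> \<sigma> \<odot>\<^bsub>?Q\<^esub> ?C f" by simp_all
      have cf: "(\<lambda>t. - \<chi> \<sigma> * f t) \<in> carrier (tableau_module T N \<mu>)" using f(1) by simp
      have "?C (\<lambda>t. ?h t + - \<chi> \<sigma> * f t) = \<chi> \<sigma> \<odot>\<^bsub>?Q\<^esub> ?C f \<oplus>\<^bsub>?Q\<^esub> (- \<chi> \<sigma>) \<odot>\<^bsub>?Q\<^esub> ?C f"
        by (simp only: S_tilde_class_add[OF h(1) cf] S_tilde_class_smult[OF f(1)] h(2))
      also have "\<dots> = \<zero>\<^bsub>?Q\<^esub>"
        using smult_l_distr[of "\<chi> \<sigma>" "- \<chi> \<sigma>" "?C f"] smult_l_null[OF Cf] Cf by simp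
      finally have "(\<Sum>t\<in>?B. g t * (?h t + - \<chi> \<sigma> * f t)) = 0"
        using h(1) cf by (intro g(3)) auto
      then show ?thesis
        by (simp add: algebra_simps sum_subtractf sum_distrib_left)
    qed
    finally show ?thesis .
  qed
  \<comment> \<open>As \<open>\<chi> \<sigma>\<close> squares to 1 it is its own inverse, so it
    appears here without inversion.\<close>
  define G where "G t = (\<Sum>\<sigma>\<in>K. \<chi> \<sigma> * g (permute_entries \<sigma> t))" for t
  have "(\<Sum>t\<in>?B. G t * f t) = (\<Sum>\<sigma>\<in>K. \<chi> \<sigma> * (\<Sum>t\<in>?B. g (permute_entries \<sigma> t) * f t))"
    by (simp add: G_def sum_distrib_right sum_distrib_left sum.swap[of _ K] mult.assoc)
  also have "\<dots> = (\<Sum>\<sigma>\<in>K. \<Sum>t\<in>?B. g t * f t)"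
    by (intro sum.cong refl) (simp add: twist \<chi>(2) flip: mult.assoc)
  also have "\<dots> = of_nat (card K) * (\<Sum>t\<in>?B. g t * f t)"
    by simp
  also have "\<dots> \<noteq> 0" using g(2) finK K(2) by auto
  finally obtain s where s: "s \<in> ?B" "G s \<noteq> 0"
    by (metis (no_types, lifting) mult_zero_left sum.neutral)
  have "G (permute_entries \<sigma> t) = \<chi> \<sigma> * G t" if \<sigma>: "\<sigma> \<in> K" for \<sigma> t
  proof -
    have \<sigma>': "\<sigma> \<circ> Hilbert_Choice.inv \<sigma> = id" "Hilbert_Choice.inv \<sigma> \<circ> \<sigma> = id"
      using permutes_inv_o[OF K(1)[OF \<sigma>]] by auto
    have "G (permute_entries \<sigma> t) = (\<Sum>\<tau>\<in>K. \<chi> \<tau> * g (permute_entries (\<tau> \<circ> \<sigma>) t))"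
      by (simp add: G_def permute_entries_comp)
    also have "\<dots> = (\<Sum>\<tau>\<in>K. \<chi> \<sigma> * (\<chi> (\<tau> \<circ> \<sigma>) * g (permute_entries (\<tau> \<circ> \<sigma>) t)))"
    proof (intro sum.cong refl)
      fix \<tau> assume "\<tau> \<in> K"
      then have "\<chi> \<sigma> * \<chi> (\<tau> \<circ> \<sigma>) = \<chi> \<tau> * (\<chi> \<sigma> * \<chi> \<sigma>)"
        using \<sigma> by (simp only: \<chi>(1) mult_ac)
      then show "\<chi> \<tau> * g (permute_entries (\<tau> \<circ> \<sigma>) t) =
          \<chi> \<sigma> * (\<chi> (\<tau> \<circ> \<sigma>) * g (permute_entries (\<tau> \<circ> \<sigma>) t))"
        by (simp only: \<chi>(2)[OF \<sigma>] mult_1_right flip: mult.assoc)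
    qed
    also have "\<dots> = (\<Sum>\<tau>\<in>K. \<chi> \<sigma> * (\<chi> \<tau> * g (permute_entries \<tau> t)))"
      by (rule sum.reindex_bij_witness[of K "\<lambda>\<tau>. \<tau> \<circ> Hilbert_Choice.inv \<sigma>" "\<lambda>\<tau>. \<tau> \<circ> \<sigma>"])
        (auto simp: comp_assoc \<sigma>' K \<sigma>)
    finally show ?thesis by (simp add: G_def sum_distrib_left)
  qed
  moreover have "garnir_functional T N \<mu> G"
    unfolding G_def by (intro garnir_functional_sum garnir_functional_permute g(1) K(1))
  ultimately show ?thesis using that s by blast
qed

section \<open>Specht modules\<close>

lemma free_perm_module_sel [simp]:
  "f \<in> carrier (free_perm_module \<phi> B) \<longleftrightarrow> (\<forall>x. x \<notin> B \<longrightarrow> f x = 0)"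
  "f \<oplus>\<^bsub>free_perm_module \<phi> B\<^esub> g = (\<lambda>x. f x + g x)"
  "c \<odot>\<^bsub>free_perm_module \<phi> B\<^esub> f = (\<lambda>x. c * f x)"
  "\<zero>\<^bsub>free_perm_module \<phi> B\<^esub> = (\<lambda>x. 0)"
  "perm_act (free_perm_module \<phi> B) \<sigma> f = (\<lambda>x. f (\<phi> (Hilbert_Choice.inv \<sigma>) x))"
  by (simp_all add: free_perm_module_def)

lemma finsum_free_perm_module:
  assumes "finite A" "\<And>i. i \<in> A \<Longrightarrow> F i \<in> carrier (free_perm_module \<phi> B)"
  shows "(\<Oplus>\<^bsub>free_perm_module \<phi> B\<^esub> i \<in> A. F i) = (\<lambda>x. \<Sum>i\<in>A. F i x)"
  using assms
proof (induction A rule: finite_induct)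
  case empty
  interpret Module.module complex_field "free_perm_module \<phi> B" by (rule module_free_perm_module)
  show ?case by simp
next
  case (insert i A)
  interpret Module.module complex_field "free_perm_module \<phi> B" by (rule module_free_perm_module)
  show ?case using insert by (subst M.finsum_insert) auto
qed

lemma tabloid_comp: "tabloid lam (\<sigma> \<circ> t) = (\<lambda>i. \<sigma> ` tabloid lam t i)"
  by (auto simp: tabloid_def fun_eq_iff)

lemma young_tableaux_comp:
  assumes "t \<in> young_tableaux N lam" "\<sigma> permutes {1..N}"
  shows "\<sigma> \<circ> t \<in> young_tableaux N lam"
  using assms by (auto simp: young_tableaux_def permutes_imp_bij intro: bij_betw_trans)

text \<open>Covers both groups of a Young tableau: the column group for
  \<open>A = column_set lam t\<close> and the row group for
  \<open>A = tabloid lam t\<close>.\<close>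

definition family_stabilizer :: "nat \<Rightarrow> ('i \<Rightarrow> nat set) \<Rightarrow> (nat \<Rightarrow> nat) set" where
  "family_stabilizer N A = {\<sigma>. \<sigma> permutes {1..N} \<and> (\<forall>i. \<sigma> ` A i = A i)}"

lemma column_stabilizer_eq: "column_stabilizer N lam t = family_stabilizer N (column_set lam t)"
  by (simp add: column_stabilizer_def family_stabilizer_def column_set_def sym_group_carrier)

lemma family_stabilizerD:
  assumes "\<sigma> \<in> family_stabilizer N A"
  shows "\<sigma> permutes {1..N}" "\<sigma> ` A i = A i"
  using assms by (auto simp: family_stabilizer_def)

lemma finite_family_stabilizer: "finite (family_stabilizer N A)"
  by (rule finite_subset[OF _ finite_permutations[of "{1..N}"]]) (auto simp: family_stabilizer_def)

lemma family_stabilizer_id: "id \<in> family_stabilizer N A"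
  by (simp add: family_stabilizer_def)

lemma family_stabilizer_comp:
  assumes "\<sigma> \<in> family_stabilizer N A" "\<tau> \<in> family_stabilizer N A"
  shows "\<sigma> \<circ> \<tau> \<in> family_stabilizer N A"
  unfolding family_stabilizer_def
  using assms[THEN family_stabilizerD(1)] assms[THEN family_stabilizerD(2)]
  by (simp add: permutes_compose image_image [symmetric])

lemma image_inv_permutes:
  assumes "\<sigma> permutes S"
  shows "Hilbert_Choice.inv \<sigma> ` \<sigma> ` A = A" "\<sigma> ` Hilbert_Choice.inv \<sigma> ` A = A"
  using permutes_inv_o[OF assms] by (simp_all add: image_comp)

lemma family_stabilizer_inv:
  assumes "\<sigma> \<in> family_stabilizer N A"
  shows "Hilbert_Choice.inv \<sigma> \<in> family_stabilizer N A"
proof -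
  have "Hilbert_Choice.inv \<sigma> ` A i = A i" for i
    using family_stabilizerD(2)[OF assms, of i]
      image_inv_permutes(1)[OF family_stabilizerD(1)[OF assms], of "A i"] by metis
  then show ?thesis
    using family_stabilizerD(1)[OF assms] by (simp add: family_stabilizer_def permutes_inv)
qed

lemma transpose_in_family_stabilizer:
  assumes "x \<in> {1..N}" "y \<in> {1..N}" "\<And>i. x \<in> A i \<longleftrightarrow> y \<in> A i"
  shows "transpose x y \<in> family_stabilizer N A"
  unfolding family_stabilizer_def using permutes_swap_id[OF assms(1,2)] assms(3)
  by (simp add: transpose_image_eq)

lemma family_stabilizer_image:
  assumes \<sigma>: "\<sigma> permutes {1..N}" and \<tau>: "\<tau> \<in> family_stabilizer N A"
  shows "\<sigma> \<circ> \<tau> \<circ> Hilbert_Choice.inv \<sigma> \<in> family_stabilizer N (\<lambda>i. \<sigma> ` A i)"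
proof -
  have "(\<sigma> \<circ> \<tau> \<circ> Hilbert_Choice.inv \<sigma>) ` \<sigma> ` A i = \<sigma> ` A i" for i
    by (metis image_comp image_inv_permutes(1)[OF \<sigma>] family_stabilizerD(2)[OF \<tau>])
  then show ?thesis
    unfolding family_stabilizer_def using \<sigma> family_stabilizerD(1)[OF \<tau>]
    by (simp only: mem_Collect_eq) (intro conjI allI permutes_compose permutes_inv; simp)
qed

lemma sign_square [simp]: "of_int (sign \<sigma>) * of_int (sign \<sigma>) = (1::complex)"
  by (cases \<sigma> rule: sign_cases) auto

lemma sign_comp_permutes:
  "\<sigma> permutes {1..N::nat} \<Longrightarrow> \<tau> permutes {1..N} \<Longrightarrow> sign (\<sigma> \<circ> \<tau>) = sign \<sigma> * sign \<tau>"
  by (intro sign_compose) (auto intro: permutes_imp_permutation[of "{1..N}"])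

lemma sign_inv_permutes:
  "\<sigma> permutes {1..N::nat} \<Longrightarrow> sign (Hilbert_Choice.inv \<sigma>) = sign \<sigma>"
  by (intro sign_inverse) (auto intro: permutes_imp_permutation[of "{1..N}"])

section \<open>Polytabloids and the group action\<close>

lemma polytabloid_eq:
  assumes "t \<in> young_tableaux N lam"
  shows "polytabloid N lam t =
    (\<lambda>R. \<Sum>\<sigma>\<in>family_stabilizer N (column_set lam t). of_int (sign \<sigma>) * basis_vec (tabloid lam (\<sigma> \<circ> t)) R)"
proof -
  have "tabloid lam (\<sigma> \<circ> t) \<in> tabloid lam ` young_tableaux N lam" if "\<sigma> \<in> family_stabilizer N (column_set lam t)" for \<sigma>
    using that assms by (intro imageI young_tableaux_comp) (auto dest: family_stabilizerD)
  then show ?thesis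
    unfolding polytabloid_def tabloid_module_def column_stabilizer_eq
    by (subst finsum_free_perm_module) (auto simp: finite_family_stabilizer basis_vec_def)
qed

lemma polytabloid_closed:
  assumes "t \<in> young_tableaux N lam"
  shows "polytabloid N lam t \<in> carrier (tabloid_module N lam)"
proof -
  have "tabloid lam (\<sigma> \<circ> t) \<in> tabloid lam ` young_tableaux N lam" if "\<sigma> \<in> family_stabilizer N (column_set lam t)" for \<sigma>
    using that assms by (intro imageI young_tableaux_comp) (auto dest: family_stabilizerD)
  then show ?thesis
    unfolding polytabloid_eq[OF assms] tabloid_module_def
    by (auto simp: basis_vec_def intro!: sum.neutral)
qed

text \<open>The row group and the column group of \<open>t\<close> meet only in the identity, since
  a cell is determined by its row and column. So only the identity contributes to this
  coefficient.\<close>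

lemma polytabloid_coeff:
  assumes t: "t \<in> young_tableaux N lam"
  shows "polytabloid N lam t (tabloid lam t) = 1"
proof -
  have inj: "inj_on t (young_diagram lam)" and im: "t ` young_diagram lam = {1..N}"
    using t by (auto simp: young_tableaux_def bij_betw_def)
  have "\<sigma> = id" if \<sigma>: "\<sigma> \<in> family_stabilizer N (column_set lam t)" and eq: "tabloid lam (\<sigma> \<circ> t) = tabloid lam t" for \<sigma>
  proof
    fix x
    have perm: "\<sigma> permutes {1..N}" and col: "\<And>j. \<sigma> ` column_set lam t j = column_set lam t j"
      using family_stabilizerD[OF \<sigma>] by auto
    have row: "\<sigma> ` tabloid lam t i = tabloid lam t i" for i
      using eq by (simp add: tabloid_comp fun_eq_iff)
    show "\<sigma> x = id x"
    proof (cases "x \<in> {1..N}")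
      case True
      then obtain i j where ij: "(i, j) \<in> young_diagram lam" "x = t (i, j)"
        using im by (metis imageE surj_pair)
      have "\<sigma> x \<in> \<sigma> ` column_set lam t j" "\<sigma> x \<in> \<sigma> ` tabloid lam t i"
        using ij by (auto simp: column_set_def tabloid_def)
      then obtain k l where "(k, j) \<in> young_diagram lam" "\<sigma> x = t (k, j)"
          "(i, l) \<in> young_diagram lam" "\<sigma> x = t (i, l)"
        unfolding col row by (auto simp: column_set_def tabloid_def)
      then show ?thesis using ij inj by (auto dest!: inj_onD)
    qed (use perm in \<open>simp add: permutes_not_in\<close>)
  qed
  then have "(\<Sum>\<sigma>\<in>family_stabilizer N (column_set lam t). of_int (sign \<sigma>) * basis_vec (tabloid lam (\<sigma> \<circ> t)) (tabloid lam t)) =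
      (\<Sum>\<sigma>\<in>family_stabilizer N (column_set lam t). if \<sigma> = id then 1 else (0::complex))"
    by (intro sum.cong refl) (auto simp: basis_vec_def)
  then show ?thesis
    by (simp add: polytabloid_eq[OF t] finite_family_stabilizer family_stabilizer_id)
qed

text \<open>Conjugation by \<open>\<sigma>\<close> carries the column group of \<open>t\<close> to
  that of \<open>\<sigma> \<circ> t\<close> and preserves signs.\<close>

lemma perm_act_polytabloid:
  assumes t: "t \<in> young_tableaux N lam" and \<sigma>: "\<sigma> permutes {1..N}"
  shows "perm_act (tabloid_module N lam) \<sigma> (polytabloid N lam t) = polytabloid N lam (\<sigma> \<circ> t)"
proof
  fix R
  let ?i = "Hilbert_Choice.inv \<sigma>"
  note io = permutes_inv_o[OF \<sigma>] and inv = permutes_inv[OF \<sigma>]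
  have col: "column_set lam (\<sigma> \<circ> t) = (\<lambda>j. \<sigma> ` column_set lam t j)"
    by (auto simp: column_set_def fun_eq_iff)
  note cancel = image_inv_permutes[OF \<sigma>]
  have conj: "\<sigma> \<circ> \<tau> \<circ> ?i \<in> family_stabilizer N (column_set lam (\<sigma> \<circ> t))"
    if "\<tau> \<in> family_stabilizer N (column_set lam t)" for \<tau>
    unfolding col by (rule family_stabilizer_image[OF \<sigma> that])
  have conj': "?i \<circ> \<tau> \<circ> \<sigma> \<in> family_stabilizer N (column_set lam t)"
    if "\<tau> \<in> family_stabilizer N (column_set lam (\<sigma> \<circ> t))" for \<tau>
    using family_stabilizer_image[OF inv that] by (simp add: col cancel permutes_inv_inv[OF \<sigma>])
  have sgn: "sign (\<sigma> \<circ> \<tau> \<circ> ?i) = sign \<tau>" if "\<tau> permutes {1..N}" for \<tau>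
  proof -
    have "sign \<sigma> * sign \<sigma> = (1::int)" by (cases \<sigma> rule: sign_cases) auto
    then show ?thesis
      using sign_comp_permutes[OF permutes_compose[OF that \<sigma>] inv] sign_comp_permutes[OF \<sigma> that]
        sign_inv_permutes[OF \<sigma>] by simp
  qed
  \<comment> \<open>The action on functions precomposes with the inverse; this moves
    \<open>\<sigma>\<close> from the argument to the index of the basis vector.\<close>
  have eq: "(\<lambda>i. ?i ` R i) = tabloid lam (\<tau> \<circ> t) \<longleftrightarrow> R = tabloid lam (\<sigma> \<circ> \<tau> \<circ> t)" for \<tau>
    unfolding tabloid_comp fun_eq_iff comp_assoc by (metis cancel)
  have "perm_act (tabloid_module N lam) \<sigma> (polytabloid N lam t) R =
      (\<Sum>\<tau>\<in>family_stabilizer N (column_set lam t). of_int (sign \<tau>) * basis_vec (tabloid lam (\<sigma> \<circ> \<tau> \<circ> t)) R)"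
    by (simp add: tabloid_module_def polytabloid_eq[OF t] basis_vec_def eq)
  also have "\<dots> = (\<Sum>\<tau>\<in>family_stabilizer N (column_set lam (\<sigma> \<circ> t)).
      of_int (sign \<tau>) * basis_vec (tabloid lam (\<tau> \<circ> (\<sigma> \<circ> t))) R)"
  proof (rule sum.reindex_bij_witness[of _ "\<lambda>\<tau>. ?i \<circ> \<tau> \<circ> \<sigma>" "\<lambda>\<tau>. \<sigma> \<circ> \<tau> \<circ> ?i"])
    fix \<tau> assume \<tau>: "\<tau> \<in> family_stabilizer N (column_set lam t)"
    have "\<sigma> \<circ> \<tau> \<circ> ?i \<circ> (\<sigma> \<circ> t) = \<sigma> \<circ> \<tau> \<circ> t"
      using io(2) by (metis comp_assoc comp_id)
    then show "of_int (sign (\<sigma> \<circ> \<tau> \<circ> ?i)) * basis_vec (tabloid lam (\<sigma> \<circ> \<tau> \<circ> ?i \<circ> (\<sigma> \<circ> t))) R =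
        of_int (sign \<tau>) * basis_vec (tabloid lam (\<sigma> \<circ> \<tau> \<circ> t)) R"
      by (simp add: sgn[OF family_stabilizerD(1)[OF \<tau>]])
    show "\<sigma> \<circ> \<tau> \<circ> ?i \<in> family_stabilizer N (column_set lam (\<sigma> \<circ> t))" by (rule conj[OF \<tau>])
    show "?i \<circ> (\<sigma> \<circ> \<tau> \<circ> ?i) \<circ> \<sigma> = \<tau>" using io by (metis comp_assoc comp_id id_comp)
  next
    fix \<tau> assume \<tau>: "\<tau> \<in> family_stabilizer N (column_set lam (\<sigma> \<circ> t))"
    show "?i \<circ> \<tau> \<circ> \<sigma> \<in> family_stabilizer N (column_set lam t)" by (rule conj'[OF \<tau>])
    show "\<sigma> \<circ> (?i \<circ> \<tau> \<circ> \<sigma>) \<circ> ?i = \<tau>" using io by (metis comp_assoc comp_id id_comp)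
  qed
  also have "\<dots> = polytabloid N lam (\<sigma> \<circ> t) R"
    by (simp add: polytabloid_eq[OF young_tableaux_comp[OF t \<sigma>]])
  finally show "perm_act (tabloid_module N lam) \<sigma> (polytabloid N lam t) R = polytabloid N lam (\<sigma> \<circ> t) R" .
qed

text \<open>An element of the column group leaves the column sets unchanged, so the sum runs over
  the same group; right translation by \<open>\<sigma>\<close> costs one factor
  \<open>sign \<sigma>\<close>.\<close>

lemma polytabloid_column_stabilizer:
  assumes t: "t \<in> young_tableaux N lam" and \<sigma>: "\<sigma> \<in> family_stabilizer N (column_set lam t)"
  shows "polytabloid N lam (\<sigma> \<circ> t) = (\<lambda>R. of_int (sign \<sigma>) * polytabloid N lam t R)"
proof
  fix R
  have perm: "\<sigma> permutes {1..N}" and col: "\<And>j. \<sigma> ` column_set lam t j = column_set lam t j"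
    using family_stabilizerD[OF \<sigma>] by auto
  have "column_set lam (\<sigma> \<circ> t) j = \<sigma> ` column_set lam t j" for j
    by (auto simp: column_set_def)
  then have stab: "column_set lam (\<sigma> \<circ> t) = column_set lam t"
    by (simp add: fun_eq_iff col)
  note io = permutes_inv_o[OF perm] and inv = family_stabilizer_inv[OF \<sigma>]
  have "polytabloid N lam (\<sigma> \<circ> t) R =
      (\<Sum>\<tau>\<in>family_stabilizer N (column_set lam t). of_int (sign \<tau>) * basis_vec (tabloid lam (\<tau> \<circ> \<sigma> \<circ> t)) R)"
    using polytabloid_eq[OF young_tableaux_comp[OF t perm]] by (simp add: stab comp_assoc)
  also have "\<dots> = (\<Sum>\<tau>\<in>family_stabilizer N (column_set lam t).
      of_int (sign \<sigma>) * (of_int (sign (\<tau> \<circ> \<sigma>)) * basis_vec (tabloid lam (\<tau> \<circ> \<sigma> \<circ> t)) R))"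
  proof (intro sum.cong refl)
    fix \<tau> assume "\<tau> \<in> family_stabilizer N (column_set lam t)"
    then have "sign (\<tau> \<circ> \<sigma>) = sign \<tau> * sign \<sigma>"
      using perm by (intro sign_comp_permutes) (auto dest: family_stabilizerD)
    then have "of_int (sign \<sigma>) * of_int (sign (\<tau> \<circ> \<sigma>)) =
        of_int (sign \<tau>) * (of_int (sign \<sigma>) * of_int (sign \<sigma>) :: complex)"
      by (simp only: of_int_mult mult_ac)
    then show "of_int (sign \<tau>) * basis_vec (tabloid lam (\<tau> \<circ> \<sigma> \<circ> t)) R =
        of_int (sign \<sigma>) * (of_int (sign (\<tau> \<circ> \<sigma>)) * basis_vec (tabloid lam (\<tau> \<circ> \<sigma> \<circ> t)) R)"
      by (simp only: sign_square mult_1_right flip: mult.assoc)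
  qed
  also have "\<dots> = (\<Sum>\<tau>\<in>family_stabilizer N (column_set lam t).
      of_int (sign \<sigma>) * (of_int (sign \<tau>) * basis_vec (tabloid lam (\<tau> \<circ> t)) R))"
    by (rule sum.reindex_bij_witness[of _ "\<lambda>\<tau>. \<tau> \<circ> Hilbert_Choice.inv \<sigma>" "\<lambda>\<tau>. \<tau> \<circ> \<sigma>"])
      (auto simp: comp_assoc io intro: family_stabilizer_comp \<sigma> inv)
  finally show "polytabloid N lam (\<sigma> \<circ> t) R = of_int (sign \<sigma>) * polytabloid N lam t R"
    by (simp add: polytabloid_eq[OF t] sum_distrib_left)
qed

lemma specht_module_sel [simp]:
  "ring.add (specht_module N lam) = ring.add (tabloid_module N lam)"
  "module.smult (specht_module N lam) = module.smult (tabloid_module N lam)"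
  "perm_act (specht_module N lam) = perm_act (tabloid_module N lam)"
  by (simp_all add: specht_module_def)

lemma submodule_specht:
  "submodule (carrier (specht_module N lam)) complex_field (tabloid_module N lam)"
proof -
  have "Module.module complex_field (tabloid_module N lam)"
    unfolding tabloid_module_def by (rule module_free_perm_module)
  then show ?thesis
    unfolding specht_module_def
    by (simp, intro submodule_submodule_span image_subsetI polytabloid_closed)
qed

lemma polytabloid_in_specht:
  "t \<in> young_tableaux N lam \<Longrightarrow> polytabloid N lam t \<in> carrier (specht_module N lam)"
  by (simp add: specht_module_def submodule_span_def hull_inc)

lemma specht_sum_closed:
  assumes "\<And>i. i \<in> A \<Longrightarrow> F i \<in> carrier (specht_module N lam)"
  shows "(\<lambda>R. \<Sum>i\<in>A. F i R) \<in> carrier (specht_module N lam)"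
proof -
  interpret Module.module complex_field "tabloid_module N lam"
    unfolding tabloid_module_def by (rule module_free_perm_module)
  have 0: "(\<lambda>R. 0) \<in> carrier (specht_module N lam)"
    using submodule_specht[of N lam]
    by (auto simp: submodule_def tabloid_module_def dest!: subgroup.one_closed)
  have add: "(\<lambda>R. f R + g R) \<in> carrier (specht_module N lam)"
    if "f \<in> carrier (specht_module N lam)" "g \<in> carrier (specht_module N lam)" for f g
    using submoduleE(5)[OF submodule_specht that] by (simp add: tabloid_module_def)
  show ?thesis
    using assms by (induction A rule: infinite_finite_induct) (auto simp: 0 add)
qed

text \<open>An embedding sends the eigenvector \<open>u\<close> to a class with the same
  eigenvalues, nonzero by injectivity, to which averaging applies.\<close>

lemma specht_garnir_functional:
  fixes \<chi> :: "(nat \<Rightarrow> nat) \<Rightarrow> complex"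
  assumes emb: "contained_in N (specht_module N lam) (S_tilde T N \<mu>)"
    and u: "u \<in> carrier (specht_module N lam)" "u \<noteq> (\<lambda>R. 0)"
    and K: "\<And>\<sigma>. \<sigma> \<in> K \<Longrightarrow> \<sigma> permutes {1..N}" "id \<in> K"
      "\<And>\<sigma> \<tau>. \<sigma> \<in> K \<Longrightarrow> \<tau> \<in> K \<Longrightarrow> \<sigma> \<circ> \<tau> \<in> K" "\<And>\<sigma>. \<sigma> \<in> K \<Longrightarrow> Hilbert_Choice.inv \<sigma> \<in> K"
    and \<chi>: "\<And>\<sigma> \<tau>. \<sigma> \<in> K \<Longrightarrow> \<tau> \<in> K \<Longrightarrow> \<chi> (\<sigma> \<circ> \<tau>) = \<chi> \<sigma> * \<chi> \<tau>" "\<And>\<sigma>. \<sigma> \<in> K \<Longrightarrow> \<chi> \<sigma> * \<chi> \<sigma> = 1"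
    and eigen: "\<And>\<sigma>. \<sigma> \<in> K \<Longrightarrow> perm_act (tabloid_module N lam) \<sigma> u = (\<lambda>R. \<chi> \<sigma> * u R)"
  obtains g s where "garnir_functional T N \<mu> g" "s \<in> tree_tableaux T N \<mu>" "g s \<noteq> 0"
    "\<And>\<sigma> t. \<sigma> \<in> K \<Longrightarrow> g (permute_entries \<sigma> t) = \<chi> \<sigma> * g t"
proof -
  let ?S = "specht_module N lam" and ?Q = "S_tilde T N \<mu>"
  interpret Module.module complex_field ?Q by (rule module_S_tilde)
  obtain F where F: "F \<in> hom (add_monoid ?S) (add_monoid ?Q)" "inj_on F (carrier ?S)"
    "\<And>c v. v \<in> carrier ?S \<Longrightarrow> F (c \<odot>\<^bsub>?S\<^esub> v) = c \<odot>\<^bsub>?Q\<^esub> F v"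
    "\<And>\<sigma> v. \<sigma> \<in> carrier (sym_group N) \<Longrightarrow> v \<in> carrier ?S \<Longrightarrow> F (perm_act ?S \<sigma> v) = perm_act ?Q \<sigma> (F v)"
    using emb unfolding contained_in_def by blast
  have smult: "c \<odot>\<^bsub>tabloid_module N lam\<^esub> v = (\<lambda>R. c * v R)" for c v
    by (simp add: tabloid_module_def)
  have Fu: "F u \<in> carrier ?Q" using F(1) u(1) by (auto simp: hom_def)
  then obtain f where f: "f \<in> carrier (tableau_module T N \<mu>)" "F u = S_tilde_class T N \<mu> f"
    unfolding carrier_S_tilde by blast
  have zero: "(\<lambda>R. 0) \<in> carrier ?S" using specht_sum_closed[of "{}"] by simp
  have "F (\<lambda>R. 0) = \<zero>\<^bsub>?Q\<^esub>"
    using F(3)[OF u(1), of 0] smult_l_null[OF Fu] by (simp add: smult)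
  then have "S_tilde_class T N \<mu> f \<noteq> \<zero>\<^bsub>?Q\<^esub>"
    using F(2) u zero f(2) by (metis inj_onD)
  moreover have "perm_act ?Q \<sigma> (S_tilde_class T N \<mu> f) = \<chi> \<sigma> \<odot>\<^bsub>?Q\<^esub> S_tilde_class T N \<mu> f" if "\<sigma> \<in> K" for \<sigma>
    using F(4)[of \<sigma> u] F(3)[OF u(1), of "\<chi> \<sigma>"] K(1) eigen that u(1) f(2)
    by (simp add: smult sym_group_carrier)
  ultimately show ?thesis
    using isotypic_garnir_functional[OF f(1) _ K \<chi>] that by blast
qed

lemma young_tableaux_nonempty:
  assumes "sum_list lam = N"
  obtains t where "t \<in> young_tableaux N lam"
proof -
  have yd: "young_diagram lam = (SIGMA i:{..<length lam}. {..<lam ! i})"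
    by (auto simp: young_diagram_def)
  have "card (young_diagram lam) = card {1..N}"
    using assms by (simp add: yd sum_list_sum_nth atLeast0LessThan)
  moreover have "finite (young_diagram lam)" by (simp add: yd)
  ultimately show ?thesis
    using that finite_same_card_bij[of "young_diagram lam" "{1..N}"] by (auto simp: young_tableaux_def)
qed

theorem theorem6p8:
  fixes T :: plane_tree and N :: nat and \<mu> :: "nat list \<Rightarrow> nat" and lam :: "nat list"
  assumes "T_partition T N \<mu>"
    and "is_partition N lam"
    and "contained_in N (specht_module N lam) (S_tilde T N \<mu>)"
  shows "num_columns lam = card (nodes T) \<and>
         column_length lam (num_columns lam - 1) = \<mu> []"
proof -
  define n where "n = card (nodes T)"
  obtain t where t: "t \<in> young_tableaux N lam"
    using young_tableaux_nonempty assms(2) by (auto simp: is_partition_def)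
  have entries: "t ` young_diagram lam = {1..N}"
    using t by (auto simp: young_tableaux_def bij_betw_def)
  define R where "R = family_stabilizer N (tabloid lam t)"
  \<comment> \<open>The polytabloid of \<open>t\<close> symmetrized over the row group
    \<open>R\<close>. It is nonzero: elements of \<open>R\<close> fix the tabloid of
    \<open>t\<close>, so every summand has coefficient 1 there.\<close>
  define u where "u = (\<lambda>X. \<Sum>\<rho>\<in>R. polytabloid N lam (\<rho> \<circ> t) X)"
  have u_in: "u \<in> carrier (specht_module N lam)"
    unfolding u_def by (intro specht_sum_closed polytabloid_in_specht young_tableaux_comp t) (auto simp: R_def dest: family_stabilizerD)
  have "u (tabloid lam t) = (\<Sum>\<rho>\<in>R. 1)"
    unfolding u_def
  proof (intro sum.cong refl)
    fix \<rho> assume "\<rho> \<in> R"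
    then have "\<rho> permutes {1..N}" "\<And>i. \<rho> ` tabloid lam t i = tabloid lam t i"
      unfolding R_def by (fact family_stabilizerD)+
    then have "tabloid lam (\<rho> \<circ> t) = tabloid lam t" "\<rho> \<circ> t \<in> young_tableaux N lam"
      using young_tableaux_comp[OF t] by (simp_all add: tabloid_comp)
    then show "polytabloid N lam (\<rho> \<circ> t) (tabloid lam t) = 1"
      using polytabloid_coeff by metis
  qed
  moreover have "card R \<noteq> 0"
    unfolding R_def using family_stabilizer_id finite_family_stabilizer by (metis card_eq_0_iff empty_iff)
  ultimately have u_nonzero: "u \<noteq> (\<lambda>X. 0)" by auto
  have u_inv: "perm_act (tabloid_module N lam) \<sigma> u = (\<lambda>X. 1 * u X)" if \<sigma>: "\<sigma> \<in> R" for \<sigma>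
  proof
    fix X
    have perm: "\<sigma> permutes {1..N}" using \<sigma> unfolding R_def by (rule family_stabilizerD)
    have act: "perm_act (tabloid_module N lam) \<sigma> (polytabloid N lam (\<rho> \<circ> t)) =
        polytabloid N lam (\<sigma> \<circ> \<rho> \<circ> t)" if "\<rho> \<in> R" for \<rho>
      using perm_act_polytabloid[OF young_tableaux_comp[OF t family_stabilizerD(1)[OF that[unfolded R_def]]] perm]
      by (simp only: comp_assoc)
    have "perm_act (tabloid_module N lam) \<sigma> u X =
        (\<Sum>\<rho>\<in>R. perm_act (tabloid_module N lam) \<sigma> (polytabloid N lam (\<rho> \<circ> t)) X)"
      by (simp add: tabloid_module_def u_def)
    also have "\<dots> = (\<Sum>\<rho>\<in>R. polytabloid N lam (\<sigma> \<circ> \<rho> \<circ> t) X)"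
      by (intro sum.cong refl) (simp only: act)
    also have "\<dots> = (\<Sum>\<rho>\<in>R. polytabloid N lam (\<rho> \<circ> t) X)"
      by (rule sum.reindex_bij_witness[of _ "\<lambda>\<rho>. Hilbert_Choice.inv \<sigma> \<circ> \<rho>" "\<lambda>\<rho>. \<sigma> \<circ> \<rho>"])
        (use \<sigma> in \<open>auto simp: R_def family_stabilizer_comp family_stabilizer_inv permutes_inv_o[OF perm] simp flip: comp_assoc\<close>)
    finally show "perm_act (tabloid_module N lam) \<sigma> u X = 1 * u X" by (simp add: u_def)
  qed
  \<comment> \<open>The trivial character of the row group gives the functional behind both upper
    bounds.\<close>
  obtain g s where g: "garnir_functional T N \<mu> g" "s \<in> tree_tableaux T N \<mu>" "g s \<noteq> 0"
    "\<And>\<sigma> t. \<sigma> \<in> R \<Longrightarrow> g (permute_entries \<sigma> t) = 1 * g t"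
    by (rule specht_garnir_functional[OF assms(3) u_in u_nonzero, of R "\<lambda>_. 1"])
      (use u_inv in \<open>auto simp: R_def family_stabilizer_id family_stabilizer_comp family_stabilizer_inv dest: family_stabilizerD(1)\<close>)
  have row_transpose: "transpose x y \<in> R" if xy: "x \<in> tabloid lam t i" "y \<in> tabloid lam t i" for x y i
  proof -
    have mem: "x \<in> tabloid lam t k \<longleftrightarrow> y \<in> tabloid lam t k" for k
      using xy t by (fastforce simp: tabloid_def young_tableaux_def bij_betw_def dest: inj_onD)
    have "x \<in> {1..N}" "y \<in> {1..N}"
      using xy entries by (auto simp: tabloid_def)
    then show ?thesis
      using mem unfolding R_def by (rule transpose_in_family_stabilizer)
  qed
  have len: "lam ! i \<le> n" if "i < length lam" for i
    unfolding n_def using row_length_bound(1)[OF g(1-3) t _ that] g(4) row_transpose by simp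
  have le: "card {i. (i, n - 1) \<in> young_diagram lam} \<le> \<mu> []"
    unfolding n_def using row_length_bound(2)[OF g(1-3) t] g(4) row_transpose by simp
  let ?C = "family_stabilizer N (column_set lam t)"
  have "polytabloid N lam t \<noteq> (\<lambda>X. 0)"
    using polytabloid_coeff[OF t] by (metis zero_neq_one)
  \<comment> \<open>The polytabloid of \<open>t\<close> is an eigenvector for the sign character of
    the column group, which gives an alternating functional.\<close>
  then obtain g' s' where g': "garnir_functional T N \<mu> g'" "s' \<in> tree_tableaux T N \<mu>" "g' s' \<noteq> 0"
    "\<And>\<sigma> t. \<sigma> \<in> ?C \<Longrightarrow> g' (permute_entries \<sigma> t) = of_int (sign \<sigma>) * g' t"
    by (rule specht_garnir_functional[OF assms(3) polytabloid_in_specht[OF t], of ?C "\<lambda>\<sigma>. of_int (sign \<sigma>)"])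
      (auto simp: family_stabilizer_id family_stabilizer_comp family_stabilizer_inv perm_act_polytabloid[OF t]
        polytabloid_column_stabilizer[OF t] family_stabilizerD(1) sign_comp_permutes[OF family_stabilizerD(1) family_stabilizerD(1)]
        simp del: One_nat_def)
  have anti: "g' (switch_entries x y v) = - g' v"
    if xy: "x \<in> column_set lam t j" "y \<in> column_set lam t j" "x \<noteq> y" for x y j v
  proof -
    have mem: "x \<in> column_set lam t k \<longleftrightarrow> y \<in> column_set lam t k" for k
      using xy t by (fastforce simp: column_set_def young_tableaux_def bij_betw_def dest: inj_onD)
    have "x \<in> {1..N}" "y \<in> {1..N}"
      using xy entries by (auto simp: column_set_def)
    then have "transpose x y \<in> ?C"
      using mem by (rule transpose_in_family_stabilizer)
    then show ?thesis using g'(4) xy(3) by (simp add: sign_swap_id)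
  qed
  have "\<mu> [] \<le> card {i. (i, n - 1) \<in> young_diagram lam}"
    unfolding n_def using root_label_le_last_column[OF g'(1-3) t] len anti by (simp add: n_def)
  with le have col: "column_length lam (n - 1) = \<mu> []"
    by (simp add: column_length_def)
  moreover have "0 < \<mu> []" using assms(1) by (simp add: T_partition_def)
  \<comment> \<open>A positive root label forces a cell in column \<open>n - 1\<close>. Since
    \<open>0 < n\<close> and no row is longer than \<open>n\<close>, the columns are exactly those
    numbered below \<open>n\<close>.\<close>
  ultimately have "{i. (i, n - 1) \<in> young_diagram lam} \<noteq> {}"
    unfolding column_length_def by (intro notI) simp
  then obtain i where "(i, n - 1) \<in> young_diagram lam" by blast
  moreover have "0 < n" by (simp add: n_def card_gt_0_iff finite_nodes)
  ultimately have "snd ` young_diagram lam = {..<n}"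
    using len by (force simp: young_diagram_def image_iff)
  then have "num_columns lam = n" by (simp add: num_columns_def)
  with col show ?thesis by (simp add: n_def)
qed

end
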